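(* Let $d\geq 2$ be a fixed integer. For a positive integer $N$, let $S(d,N)$ denote the number of permutations in the symmetric group $\mathfrak{S}(N)$ having no decreasing subsequence of length $d+1$. For positive integers $d,q$, let $R(d,q)$ denote the $d\times q$ rectangular Young diagram (with $d$ rows each of length $q$), and let $\dim R(d,q)$ denote the number of standard Young tableaux of shape $R(d,q)$. Then, as $n\to\infty$, $$S(d,dn)\sim \dim R(d,2n),$$ i.e. $S(d,dn)/\dim R(d,2n)\to 1$.
   Context: For a Young diagram $\lambda$, $\dim\lambda$ denotes the number of standard Young tableaux of shape $\lambda$. $R(d,q)$ is the Young diagram $(q,q,\dots,q)$ with $d$ parts. *)

theory Defs
  imports
    Complex_Main
    "HOL-Library.FuncSet"
    "HOL-Library.Landau_Symbols"
    "HOL-Combinatorics.Permutations"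
begin

text \<open>A decreasing subsequence of length \<open>k\<close> of the word \<open>\<pi> 1, \<dots>, \<pi> N\<close> is given by the
  set \<open>I\<close> of its \<open>k\<close> positions.\<close>

definition has_decreasing_subseq :: "nat \<Rightarrow> nat \<Rightarrow> (nat \<Rightarrow> nat) \<Rightarrow> bool" where
  "has_decreasing_subseq k N \<pi> \<longleftrightarrow>
     (\<exists>I \<subseteq> {1..N}. card I = k \<and> strict_antimono_on I \<pi>)"

definition num_perms_no_decreasing :: "nat \<Rightarrow> nat \<Rightarrow> nat" where
  "num_perms_no_decreasing d N = card {\<pi>. \<pi> permutes {1..N} \<and> \<not> has_decreasing_subseq (d + 1) N \<pi>}"

text \<open>A Young diagram is represented by the list of its row lengths; its cells are
  pairs (row, column), both counted from 0.\<close>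

definition young_diagram :: "nat list \<Rightarrow> bool" where
  "young_diagram \<mu> \<longleftrightarrow> sorted_wrt (\<ge>) \<mu> \<and> 0 \<notin> set \<mu>"

definition diagram_cells :: "nat list \<Rightarrow> (nat \<times> nat) set" where
  "diagram_cells \<mu> = {(i, j). i < length \<mu> \<and> j < \<mu> ! i}"

text \<open>Tableaux are required to be extensional, i.e. \<open>undefined\<close> off the diagram, so that
  distinct functions are distinct fillings.\<close>

definition standard_tableaux :: "nat list \<Rightarrow> (nat \<times> nat \<Rightarrow> nat) set" where
  "standard_tableaux \<mu> =
     {T \<in> extensional (diagram_cells \<mu>).
        bij_betw T (diagram_cells \<mu>) {1..sum_list \<mu>} \<and>
        (\<forall>i j j'. (i, j) \<in> diagram_cells \<mu> \<and> (i, j') \<in> diagram_cells \<mu> \<and> j < j' \<longrightarrow> T (i, j) < T (i, j')) \<and>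
        (\<forall>i i' j. (i, j) \<in> diagram_cells \<mu> \<and> (i', j) \<in> diagram_cells \<mu> \<and> i < i' \<longrightarrow> T (i, j) < T (i', j))}"

definition dim_diagram :: "nat list \<Rightarrow> nat" where
  "dim_diagram \<mu> = card (standard_tableaux \<mu>)"

definition rect_diagram :: "nat \<Rightarrow> nat \<Rightarrow> nat list" where
  "rect_diagram d q = replicate d q"

lemma young_diagram_rect_diagram: "q > 0 \<Longrightarrow> young_diagram (rect_diagram d q)"
  by (induction d) (auto simp: young_diagram_def rect_diagram_def)

end

theory Submission
  imports Defs "Jordan_Normal_Form.Determinant" "HOL-Real_Asymp.Real_Asymp"
begin

text \<open>
  By the Robinson--Schensted correspondence, \<open>S(d,dn)\<close> is the sum of \<open>(dim \<lambda>)\<^sup>2\<close> over the diagrams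
  \<open>\<lambda>\<close> with \<open>dn\<close> cells and at most \<open>d\<close> rows. Stopping a standard tableau of shape \<open>R(d,2n)\<close> half way
  shows that \<open>dim R(d,2n)\<close> is the sum of \<open>dim \<lambda> \<cdot> dim \<lambda>'\<close>, where \<open>\<lambda>'\<close> is the rotated complement of
  \<open>\<lambda>\<close> in the rectangle. In the formula \<open>dim \<lambda> = N! V(l) / \<Prod> l\<^sub>i!\<close>, with \<open>l\<^sub>i\<close> the shifted row lengths and
  \<open>V\<close> their Vandermonde determinant, \<open>V\<close> is invariant under \<open>\<lambda> \<mapsto> \<lambda>'\<close>, so that \<open>dim \<lambda>' / dim \<lambda>\<close> is the
  product of the \<open>l\<^sub>i! / (M - l\<^sub>i)!\<close> with \<open>M = 2n + d - 1\<close>. It tends to 1 uniformly when all rows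
  have length \<open>n + O(n\<^bsup>3/5\<^esup>)\<close>: since \<open>\<Sum> (2 l\<^sub>i - M) = 0\<close>, the leading terms cancel. The other diagrams
  contribute exponentially little to both sums, compared with the single diagram \<open>R(d,n)\<close>.
\<close>

section \<open>The falling factorial determinant\<close>

text \<open>Neither side is evaluated asymptotically; only their ratio is estimated, by comparing
  summands. For fixed \<open>d\<close>, powers of \<open>n\<close> may therefore be bounded crudely,
  since the exponential decay off the centre absorbs them. Off the centre the complement ratio gives
  no control, and the two index sets differ, as only the second sum confines the diagrams to width
  \<open>2 n\<close>. Both obstacles are met by 2xy \<le> x^2 + y^2 and the fact that
  complementation is an involution of the non-central shapes in the box: the tail of the second sum
  is bounded by that of the first. Tableaux, permutations and halves of a rectangle are all counted
  by one notion, saturated chains in Young's lattice: a chain is a tableau built cell by cell, the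
  recursion over its last step is that of the determinant, and two chains with a common end are the
  far sides of a growth diagram.\<close>

lemma permutes_less: "\<sigma> permutes {0..<d :: nat} \<Longrightarrow> i < d \<Longrightarrow> \<sigma> i < d"
  using permutes_in_image[of \<sigma> "{0..<d}" i] by simp

definition ffpoly :: "nat \<Rightarrow> int poly" where
  "ffpoly j = (\<Prod>k<j. [:- int k, 1:])"

text \<open>Since \<open>ffpoly j\<close> is monic of degree \<open>j\<close>, this is the
  Vandermonde determinant of \<open>l\<close>. The falling factorial basis is chosen because
  replacing \<open>l i\<close> by \<open>l i - 1\<close> then changes row \<open>i\<close> by
  explicit factors.\<close>

definition ffdet :: "nat \<Rightarrow> (nat \<Rightarrow> int) \<Rightarrow> int" where
  "ffdet d l = det (mat d d (\<lambda>(i, j). poly (ffpoly j) (l i)))"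

lemma poly_ffpoly: "poly (ffpoly j) x = (\<Prod>k<j. x - int k)"
  by (simp add: ffpoly_def poly_prod)

text \<open>Both sides are the product of \<open>x - k\<close> over all
  \<open>k \<le> j\<close>.\<close>

lemma poly_ffpoly_pred: "x * poly (ffpoly j) (x - 1) = (x - int j) * poly (ffpoly j) x"
proof -
  have "x * (\<Prod>k<j. x - 1 - int k) = (x - int j) * (\<Prod>k<j. x - int k)"
  proof (induction j)
    case (Suc j)
    have "x * (\<Prod>k<Suc j. x - 1 - int k) = (x * (\<Prod>k<j. x - 1 - int k)) * (x - 1 - int j)"
      by (simp add: mult_ac)
    also have "\<dots> = (x - int (Suc j)) * (\<Prod>k<Suc j. x - int k)"
      by (subst Suc) (simp add: algebra_simps)
    finally show ?case .
  qed simp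
  thus ?thesis by (simp add: poly_ffpoly)
qed

text \<open>The matrix is the Vandermonde matrix times the upper triangular matrix of
  coefficients.\<close>

lemma det_poly_eval:
  fixes p :: "nat \<Rightarrow> 'a :: comm_ring_1 poly" and x :: "nat \<Rightarrow> 'a"
  assumes deg: "\<And>j. j < d \<Longrightarrow> degree (p j) \<le> j"
  shows "det (mat d d (\<lambda>(i, j). poly (p j) (x i))) =
           det (mat d d (\<lambda>(i, j). x i ^ j)) * (\<Prod>j<d. coeff (p j) j)"
proof -
  let ?X = "mat d d (\<lambda>(i, j). x i ^ j)"
  let ?C = "mat d d (\<lambda>(k, j). coeff (p j) k)"
  have "mat d d (\<lambda>(i, j). poly (p j) (x i)) = ?X * ?C"
  proof (rule eq_matI)
    fix i j assume "i < dim_row (?X * ?C)" "j < dim_col (?X * ?C)"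
    hence ij: "i < d" "j < d" by auto
    have "poly (p j) (x i) = (\<Sum>k\<le>degree (p j). coeff (p j) k * x i ^ k)"
      by (simp add: poly_altdef)
    also have "\<dots> = (\<Sum>k<d. coeff (p j) k * x i ^ k)"
      using deg[OF ij(2)] ij(2) by (intro sum.mono_neutral_left) (auto simp: coeff_eq_0 not_le)
    finally show "mat d d (\<lambda>(i, j). poly (p j) (x i)) $$ (i, j) = (?X * ?C) $$ (i, j)"
      using ij by (simp add: scalar_prod_def mult.commute lessThan_atLeast0)
  qed auto
  moreover have "det ?C = (\<Prod>j<d. coeff (p j) j)"
  proof -
    have "upper_triangular ?C"
      unfolding upper_triangular_def using deg by (auto intro!: coeff_eq_0 le_less_trans[OF deg])
    hence "det ?C = prod_list (diag_mat ?C)"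
      by (rule det_upper_triangular) auto
    also have "\<dots> = (\<Prod>j<d. coeff (p j) j)"
      by (simp add: diag_mat_def prod.list_conv_set_nth lessThan_atLeast0)
    finally show ?thesis .
  qed
  ultimately show ?thesis
    by (simp add: det_mult[of _ d])
qed

lemma degree_prod_linear_le: "degree (\<Prod>k<j. [:a k, b :: 'a :: comm_ring_1:]) \<le> j"
proof (induction j)
  case (Suc j)
  show ?case
    using degree_mult_le[of "\<Prod>k<j. [:a k, b:]" "[:a j, b:]"] Suc
    by (simp del: mult_pCons_right split: if_splits)
qed auto

lemma coeff_prod_linear: "coeff (\<Prod>k<j. [:a k, b :: 'a :: comm_ring_1:]) j = b ^ j"
proof (induction j)
  case (Suc j)
  have "coeff (\<Prod>k<j. [:a k, b:]) (Suc j) = 0"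
    by (rule coeff_eq_0) (use degree_prod_linear_le[of a b j] in simp)
  thus ?case using Suc by (simp add: mult.commute[of _ "[:a j, b:]"])
qed auto

text \<open>The reflected columns come from polynomials with leading coefficient
  \<open>(-1) ^ j\<close>, so both determinants are the Vandermonde determinant up to sign. The sign
  is not tracked; for shapes it is recovered later from nonnegativity.\<close>

lemma ffdet_reflect: "\<bar>ffdet d (\<lambda>i. M - l i)\<bar> = \<bar>ffdet d l\<bar>"
proof -
  define p where "p j = (\<Prod>k<j. [:M - int k, -1:])" for j
  have "ffdet d (\<lambda>i. M - l i) = det (mat d d (\<lambda>(i, j). poly (p j) (l i)))"
    unfolding ffdet_def by (simp add: p_def poly_prod poly_ffpoly algebra_simps)
  also have "\<dots> = det (mat d d (\<lambda>(i, j). l i ^ j)) * (\<Prod>j<d. coeff (p j) j)"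
    by (rule det_poly_eval) (auto simp: p_def intro: degree_prod_linear_le)
  also have "\<bar>\<dots>\<bar> = \<bar>det (mat d d (\<lambda>(i, j). l i ^ j))\<bar>"
    by (simp add: p_def coeff_prod_linear abs_mult abs_prod power_abs)
  also have "det (mat d d (\<lambda>(i, j). l i ^ j)) = ffdet d l"
    unfolding ffdet_def
    by (subst det_poly_eval) (auto simp: ffpoly_def coeff_prod_linear degree_prod_linear_le)
  finally show ?thesis .
qed

lemma ffdet_permute:
  assumes "\<sigma> permutes {0..<d}"
  shows "\<bar>ffdet d (\<lambda>i. l (\<sigma> i))\<bar> = \<bar>ffdet d l\<bar>"
proof -
  have "ffdet d (\<lambda>i. l (\<sigma> i)) = signof \<sigma> * ffdet d l"
    unfolding ffdet_def using permutes_less[OF assms]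
    by (subst det_permute_rows[OF _ assms, symmetric]) (auto intro!: arg_cong[where f = det])
  thus ?thesis by (simp add: abs_mult sign_def)
qed

lemma ffdet_cong: "(\<And>i. i < d \<Longrightarrow> l i = l' i) \<Longrightarrow> ffdet d l = ffdet d l'"
  unfolding ffdet_def by (intro arg_cong[where f = det] eq_matI) auto

lemma ffdet_eq_0:
  assumes "i < d" "j < d" "i \<noteq> j" "l i = l j"
  shows "ffdet d l = 0"
  unfolding ffdet_def
  by (rule det_identical_rows[of _ d i j]) (use assms in auto)

lemma ffdet_id: "ffdet d int = (\<Prod>i<d. fact i)"
proof -
  let ?A = "mat d d (\<lambda>(i, j). poly (ffpoly j) (int i))"
  have "?A $$ (i, j) = 0" if "i < j" "j < d" for i j
    using that by (auto simp: poly_ffpoly)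
  hence "det ?A = prod_list (diag_mat ?A)"
    by (intro det_lower_triangular[of d]) auto
  also have "\<dots> = (\<Prod>i<d. poly (ffpoly i) (int i))"
    by (simp add: diag_mat_def prod.list_conv_set_nth lessThan_atLeast0)
  also have "\<dots> = (\<Prod>i<d. fact i)"
  proof (rule prod.cong)
    fix i
    have "poly (ffpoly i) (int i) = (\<Prod>k<i. int (i - k))"
      by (simp add: poly_ffpoly of_nat_diff)
    also have "\<dots> = (\<Prod>k<i. int (Suc k))"
      by (rule prod.reindex_bij_witness[of _ "\<lambda>k. i - Suc k" "\<lambda>k. i - Suc k"]) auto
    also have "\<dots> = fact i" by (simp add: fact_prod_Suc lessThan_atLeast0)
    finally show "poly (ffpoly i) (int i) = fact i" .
  qed simp
  finally show ?thesis by (simp add: ffdet_def)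
qed

text \<open>
  Lowering \<open>l i\<close> multiplies row \<open>i\<close>, up to the factor \<open>l i\<close>, by \<open>l i - j\<close> in column \<open>j\<close>; in the Leibniz
  expansion these factors add up to the same number for every permutation.
\<close>

lemma ffdet_recursion:
  "(\<Sum>i<d. l i * ffdet d (l(i := l i - 1))) = ((\<Sum>i<d. l i) - (\<Sum>i<d. int i)) * ffdet d l"
proof -
  let ?P = "{\<sigma>. \<sigma> permutes {0..<d}}"
  let ?f = "\<lambda>j x. poly (ffpoly j) x"
  have det: "ffdet d l = (\<Sum>\<sigma>\<in>?P. signof \<sigma> * (\<Prod>i=0..<d. ?f (\<sigma> i) (l i)))" for l
    unfolding ffdet_def
    by (subst det_def'[of _ d]) (auto intro!: sum.cong prod.cong simp: permutes_less)
  have *: "l i * (\<Prod>k=0..<d. ?f (\<sigma> k) ((l(i := l i - 1)) k)) =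
        (l i - int (\<sigma> i)) * (\<Prod>k=0..<d. ?f (\<sigma> k) (l k))" if "i < d" for i \<sigma>
  proof -
    have "(\<Prod>k=0..<d. ?f (\<sigma> k) ((l(i := l i - 1)) k)) =
          ?f (\<sigma> i) (l i - 1) * (\<Prod>k\<in>{0..<d}-{i}. ?f (\<sigma> k) (l k))"
      using that by (subst prod.remove[of _ i]) (auto intro!: prod.cong)
    moreover have "(\<Prod>k=0..<d. ?f (\<sigma> k) (l k)) = ?f (\<sigma> i) (l i) * (\<Prod>k\<in>{0..<d}-{i}. ?f (\<sigma> k) (l k))"
      using that by (subst prod.remove[of _ i]) auto
    ultimately show ?thesis
      using poly_ffpoly_pred[of "l i" "\<sigma> i"] by (simp add: mult.assoc[symmetric])
  qed
  have "(\<Sum>i<d. l i * ffdet d (l(i := l i - 1))) =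
     (\<Sum>i<d. \<Sum>\<sigma>\<in>?P. signof \<sigma> * (l i * (\<Prod>k=0..<d. ?f (\<sigma> k) ((l(i := l i - 1)) k))))"
    unfolding det by (simp add: sum_distrib_left mult_ac)
  also have "\<dots> = (\<Sum>\<sigma>\<in>?P. \<Sum>i<d. signof \<sigma> * ((l i - int (\<sigma> i)) * (\<Prod>k=0..<d. ?f (\<sigma> k) (l k))))"
    by (subst sum.swap) (intro sum.cong refl, subst *, auto)
  also have "\<dots> = (\<Sum>\<sigma>\<in>?P. (\<Sum>i<d. l i - int (\<sigma> i)) * (signof \<sigma> * (\<Prod>k=0..<d. ?f (\<sigma> k) (l k))))"
    by (simp add: sum_distrib_left sum_distrib_right mult_ac)
  also have "\<dots> = (\<Sum>\<sigma>\<in>?P. ((\<Sum>i<d. l i) - (\<Sum>i<d. int i)) * (signof \<sigma> * (\<Prod>k=0..<d. ?f (\<sigma> k) (l k))))"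
  proof (intro sum.cong refl)
    fix \<sigma> assume "\<sigma> \<in> ?P"
    hence "(\<Sum>i<d. int (\<sigma> i)) = (\<Sum>i<d. int i)"
      using sum.permute[of \<sigma> "{0..<d}" int] by (simp add: lessThan_atLeast0 o_def)
    thus "(\<Sum>i<d. l i - int (\<sigma> i)) * (signof \<sigma> * (\<Prod>k=0..<d. ?f (\<sigma> k) (l k))) =
       ((\<Sum>i<d. l i) - (\<Sum>i<d. int i)) * (signof \<sigma> * (\<Prod>k=0..<d. ?f (\<sigma> k) (l k)))"
      by (simp add: sum_subtractf)
  qed
  also have "\<dots> = ((\<Sum>i<d. l i) - (\<Sum>i<d. int i)) * ffdet d l"
    unfolding det by (simp add: sum_distrib_left)
  finally show ?thesis .
qed

text \<open>In every factor \<open>l i - k\<close> one has \<open>k < d \<le> L\<close>, so its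
  absolute value is at most \<open>L\<close>; each entry has fewer than \<open>d\<close> factors and
  the Leibniz expansion \<open>fact d\<close> terms.\<close>

lemma ffdet_bound:
  assumes "\<And>i. i < d \<Longrightarrow> 0 \<le> l i \<and> l i \<le> L" "int d \<le> L"
  shows "\<bar>ffdet d l\<bar> \<le> fact d * L ^ (d * d)"
proof (cases "d = 0")
  case False
  let ?P = "{\<sigma>. \<sigma> permutes {0..<d}}"
  have L1: "1 \<le> L" using False assms(2) by linarith
  have bd: "\<bar>poly (ffpoly j) (l i)\<bar> \<le> L ^ d" if "i < d" "j < d" for i j
  proof -
    have "\<bar>poly (ffpoly j) (l i)\<bar> = (\<Prod>k<j. \<bar>l i - int k\<bar>)"
      by (simp add: poly_ffpoly abs_prod)
    also have "\<dots> \<le> (\<Prod>k<j. L)"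
      using assms(1)[OF that(1)] assms(2) that(2) by (intro prod_mono) auto
    also have "\<dots> \<le> L ^ d" using L1 that by (simp add: power_increasing)
    finally show ?thesis .
  qed
  have "ffdet d l = (\<Sum>\<sigma>\<in>?P. signof \<sigma> * (\<Prod>i=0..<d. poly (ffpoly (\<sigma> i)) (l i)))"
    unfolding ffdet_def
    by (subst det_def'[of _ d]) (auto intro!: sum.cong prod.cong simp: permutes_less)
  also have "\<bar>\<dots>\<bar> \<le> (\<Sum>\<sigma>\<in>?P. \<bar>signof \<sigma> * (\<Prod>i=0..<d. poly (ffpoly (\<sigma> i)) (l i))\<bar>)"
    by (rule sum_abs)
  also have "\<dots> \<le> (\<Sum>\<sigma>\<in>?P. L ^ (d * d))"
  proof (rule sum_mono)
    fix \<sigma> assume s: "\<sigma> \<in> ?P"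
    have "\<bar>signof \<sigma> * (\<Prod>i=0..<d. poly (ffpoly (\<sigma> i)) (l i))\<bar> = (\<Prod>i=0..<d. \<bar>poly (ffpoly (\<sigma> i)) (l i)\<bar>)"
      by (simp add: abs_mult sign_def abs_prod)
    also have "\<dots> \<le> (\<Prod>i=0..<d. L ^ d)"
      using s by (intro prod_mono) (auto intro!: bd simp: permutes_less)
    also have "\<dots> = L ^ (d * d)" by (simp add: power_mult)
    finally show "\<bar>signof \<sigma> * (\<Prod>i=0..<d. poly (ffpoly (\<sigma> i)) (l i))\<bar> \<le> L ^ (d * d)" .
  qed
  also have "\<dots> = fact d * L ^ (d * d)"
    by (simp add: card_permutations[of _ d])
  finally show ?thesis .
qed (auto simp: ffdet_def)

section \<open>Counting chains of shapes\<close>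

text \<open>A diagram is a function on all row indices, so that adding or removing a cell is a
  pointwise update; \<open>r d = 0\<close> means at most \<open>d\<close> rows.\<close>

definition shape :: "nat \<Rightarrow> (nat \<Rightarrow> nat) \<Rightarrow> bool" where
  "shape d r \<longleftrightarrow> antimono r \<and> r d = 0"

definition corners :: "(nat \<Rightarrow> nat) \<Rightarrow> nat set" where
  "corners r = {i. r (Suc i) < r i}"

definition remove_cell :: "(nat \<Rightarrow> nat) \<Rightarrow> nat \<Rightarrow> nat \<Rightarrow> nat" where
  "remove_cell r i = r(i := r i - 1)"

text \<open>These are the saturated chains from the empty diagram to \<open>r\<close> in Young's
  lattice, counted by their last step. For a shape \<open>r\<close> the value is 0 unless
  \<open>r\<close> has exactly \<open>n\<close> cells.\<close>

fun num_chains :: "nat \<Rightarrow> (nat \<Rightarrow> nat) \<Rightarrow> nat" where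
  "num_chains 0 r = (if r = (\<lambda>_. 0) then 1 else 0)"
| "num_chains (Suc n) r = (\<Sum>i\<in>corners r. num_chains n (remove_cell r i))"

lemma shape_ge: "shape d r \<Longrightarrow> d \<le> i \<Longrightarrow> r i = 0"
  by (metis antimonoD le_zero_eq shape_def)

lemma shapeD: "shape d r \<Longrightarrow> i \<le> j \<Longrightarrow> r j \<le> r i"
  by (auto simp: shape_def antimono_def)

lemma shapeI: "(\<And>i. r (Suc i) \<le> r i) \<Longrightarrow> r d = 0 \<Longrightarrow> shape d r"
  by (auto simp: shape_def intro: decseq_SucI)

lemma corners_subset: "shape d r \<Longrightarrow> corners r \<subseteq> {..<d}"
  by (auto simp: corners_def not_le[symmetric] shape_ge)

lemma finite_corners: "shape d r \<Longrightarrow> finite (corners r)"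
  using corners_subset finite_subset by blast

lemma shape_remove_cell: "shape d r \<Longrightarrow> i \<in> corners r \<Longrightarrow> shape d (remove_cell r i)"
  by (rule shapeI) (auto simp: remove_cell_def corners_def shape_def antimono_def intro: le_diff_conv2 Suc_leI
      dest: le_trans intro: order.trans[OF diff_le_self])

lemma sum_remove_cell:
  assumes "shape d r" "i \<in> corners r"
  shows "sum (remove_cell r i) {..<d} = sum r {..<d} - 1" and "sum r {..<d} > 0"
proof -
  have i: "i < d" "r i > 0" using assms corners_subset[OF assms(1)] by (auto simp: corners_def)
  have "sum r {..<d} = r i + sum r ({..<d} - {i})" using i by (subst sum.remove[of _ i]) auto
  moreover have "sum (remove_cell r i) {..<d} = (r i - 1) + sum r ({..<d} - {i})"
    using i by (subst sum.remove[of _ i]) (auto simp: remove_cell_def)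
  ultimately show "sum (remove_cell r i) {..<d} = sum r {..<d} - 1" "sum r {..<d} > 0" using i by auto
qed

text \<open>Shifted row lengths, listed from the bottom row to the top one, so that they increase strictly.\<close>

definition beta :: "nat \<Rightarrow> (nat \<Rightarrow> nat) \<Rightarrow> nat \<Rightarrow> nat" where
  "beta d r i = r (d - 1 - i) + i"

lemma beta_remove_cell:
  assumes "j < d" "r (d - 1 - j) > 0"
  shows "i < d \<Longrightarrow> int (beta d (remove_cell r (d - 1 - j)) i) = ((\<lambda>i. int (beta d r i))(j := int (beta d r j) - 1)) i"
  using assms by (auto simp: beta_def remove_cell_def)

text \<open>This is Frobenius' formula for the number of standard tableaux. Removing a cell lowers
  one shifted length \<open>l j\<close> by 1 and divides the product of factorials by
  \<open>l j\<close>, so the recursion of \<open>num_chains\<close> turns into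
  \<open>ffdet_recursion\<close>.\<close>

lemma num_chains_formula:
  assumes "shape d r" "sum r {..<d} = n"
  shows "real (num_chains n r) * (\<Prod>i<d. fact (beta d r i)) = fact n * of_int (ffdet d (\<lambda>i. int (beta d r i)))"
  using assms
proof (induction n arbitrary: r)
  case 0
  have r0: "r = (\<lambda>_. 0)"
  proof
    fix i show "r i = 0" using 0 by (cases "i < d") (auto simp: shape_ge)
  qed
  have "(\<lambda>i. int (beta d r i)) = int" by (simp add: beta_def r0 fun_eq_iff)
  thus ?case by (simp add: r0 ffdet_id beta_def)
next
  case (Suc n)
  define l where "l = (\<lambda>i. int (beta d r i))"
  define B where "B = (\<Prod>i<d. fact (beta d r i) :: real)"
  \<comment> \<open>The determinant recursion runs over all rows, the chain recursion over corners
    only. At a row that is not a corner, either the lowered length collides with the next smaller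
    one, or the row is an empty bottom row and \<open>l 0 = 0\<close>.\<close>
  have vanish: "l j * ffdet d (l(j := l j - 1)) = 0" if "j < d" "d - 1 - j \<notin> corners r" for j
  proof (cases "j = 0")
    case True
    hence "r (d - 1) = 0" using that Suc.prems by (simp add: corners_def shape_ge)
    thus ?thesis by (simp add: l_def beta_def True)
  next
    case False
    have "r (d - j) = r (d - 1 - j)"
      using that False shapeD[OF Suc.prems(1), of "d - 1 - j" "d - j"] by (simp add: corners_def Suc_diff_Suc)
    hence "l j - 1 = l (j - 1)" using False that by (simp add: l_def beta_def)
    hence "ffdet d (l(j := l j - 1)) = 0"
      using False that by (intro ffdet_eq_0[of j _ "j - 1"]) auto
    thus ?thesis by simp
  qed
  have step: "real (num_chains n (remove_cell r (d - 1 - j))) * B = fact n * of_int (l j * ffdet d (l(j := l j - 1)))"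
    if j: "j < d" "d - 1 - j \<in> corners r" for j
  proof -
    let ?s = "remove_cell r (d - 1 - j)"
    have eq: "d - Suc x = d - Suc j \<longleftrightarrow> x = j" if "x < d" for x using j that by auto
    have rj: "r (d - 1 - j) > 0" using j by (auto simp: corners_def)
    have "real (num_chains n ?s) * (\<Prod>i<d. fact (beta d ?s i)) = fact n * of_int (ffdet d (\<lambda>i. int (beta d ?s i)))"
      using Suc.prems sum_remove_cell[OF _ j(2)] shape_remove_cell[OF _ j(2)] by (intro Suc.IH) auto
    also have "ffdet d (\<lambda>i. int (beta d ?s i)) = ffdet d (l(j := l j - 1))"
      using beta_remove_cell[of j d r, OF j(1) rj] by (intro ffdet_cong) (auto simp: l_def)
    also have "B = l j * (\<Prod>i<d. fact (beta d ?s i))"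
    proof -
      have "B = fact (beta d r j) * (\<Prod>i\<in>{..<d}-{j}. fact (beta d r i))"
        unfolding B_def using j by (subst prod.remove[of _ j]) auto
      moreover have "(\<Prod>i<d. fact (beta d ?s i)) = (fact (beta d ?s j) * (\<Prod>i\<in>{..<d}-{j}. fact (beta d r i)) :: real)"
        using j eq by (subst prod.remove[of _ j]) (auto simp: beta_def remove_cell_def intro!: prod.cong)
      moreover have "fact (beta d r j) = real (beta d r j) * fact (beta d ?s j)"
        using rj j by (subst fact_reduce) (auto simp: beta_def remove_cell_def)
      ultimately show ?thesis by (simp add: l_def)
    qed
    ultimately show ?thesis by (simp add: mult_ac)
  qed
  have "real (num_chains (Suc n) r) * B = (\<Sum>i\<in>corners r. real (num_chains n (remove_cell r i)) * B)"
    by (simp add: sum_distrib_right)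
  also have "\<dots> = (\<Sum>j\<in>{j\<in>{..<d}. d - 1 - j \<in> corners r}. real (num_chains n (remove_cell r (d - 1 - j))) * B)"
    using corners_subset[OF Suc.prems(1)]
    by (intro sum.reindex_bij_witness[of _ "\<lambda>j. d - 1 - j" "\<lambda>j. d - 1 - j"]) (auto simp: subset_eq)
  also have "\<dots> = (\<Sum>j\<in>{j\<in>{..<d}. d - 1 - j \<in> corners r}. fact n * of_int (l j * ffdet d (l(j := l j - 1))))"
    by (intro sum.cong refl step) auto
  also have "\<dots> = (\<Sum>j<d. fact n * of_int (l j * ffdet d (l(j := l j - 1))))"
    using vanish by (intro sum.mono_neutral_left) (auto simp del: of_int_mult)
  also have "\<dots> = fact n * of_int (\<Sum>j<d. l j * ffdet d (l(j := l j - 1)))"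
    by (simp add: sum_distrib_left)
  also have "(\<Sum>j<d. l j * ffdet d (l(j := l j - 1))) = ((\<Sum>i<d. l i) - (\<Sum>i<d. int i)) * ffdet d l"
    by (rule ffdet_recursion)
  \<comment> \<open>Subtracting the shifts leaves the number of cells; this factor turns
    \<open>fact n\<close> into \<open>fact (Suc n)\<close>.\<close>
  also have "(\<Sum>i<d. l i) - (\<Sum>i<d. int i) = int (Suc n)"
  proof -
    have "(\<Sum>i<d. l i) - (\<Sum>i<d. int i) = int (\<Sum>i<d. r (d - 1 - i))"
      by (simp add: l_def beta_def sum.distrib)
    also have "(\<Sum>i<d. r (d - 1 - i)) = sum r {..<d}"
      by (rule sum.reindex_bij_witness[of _ "\<lambda>j. d - 1 - j" "\<lambda>j. d - 1 - j"]) auto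
    finally show ?thesis using Suc.prems by simp
  qed
  finally show ?case by (simp add: B_def l_def mult_ac)
qed

section \<open>Standard tableaux\<close>

definition cells :: "(nat \<Rightarrow> nat) \<Rightarrow> (nat \<times> nat) set" where
  "cells r = {(i, j). j < r i}"

definition tableaux :: "nat \<Rightarrow> (nat \<Rightarrow> nat) \<Rightarrow> (nat \<times> nat \<Rightarrow> nat) set" where
  "tableaux n r = {T \<in> extensional (cells r). bij_betw T (cells r) {1..n} \<and>
     (\<forall>i j j'. (i, j) \<in> cells r \<and> (i, j') \<in> cells r \<and> j < j' \<longrightarrow> T (i, j) < T (i, j')) \<and>
     (\<forall>i i' j. (i, j) \<in> cells r \<and> (i', j) \<in> cells r \<and> i < i' \<longrightarrow> T (i, j) < T (i', j))}"

lemma cells_remove_cell: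
  assumes "i \<in> corners r"
  shows "cells r = insert (i, r i - 1) (cells (remove_cell r i))" and "(i, r i - 1) \<notin> cells (remove_cell r i)"
  using assms by (auto simp: cells_def remove_cell_def corners_def split: if_splits)

lemma tableaux_0: "tableaux 0 r = (if r = (\<lambda>_. 0) then {\<lambda>_. undefined} else {})"
proof (cases "r = (\<lambda>_. 0)")
  case True
  thus ?thesis by (auto simp: tableaux_def cells_def bij_betw_def)
next
  case False
  then obtain i where "r i > 0" by (auto simp: fun_eq_iff)
  hence "(i, 0) \<in> cells r" by (simp add: cells_def)
  thus ?thesis using False by (auto simp: tableaux_def bij_betw_def)
qed

text \<open>The largest entry of a standard tableau sits in a corner, and deleting it leaves a
  standard tableau. Read backwards, this gives tableaux the recursion of
  \<open>num_chains\<close>.\<close>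

lemma bij_betw_add_max_cell:
  assumes "shape d r"
  shows "bij_betw (\<lambda>(i, T). T((i, r i - 1) := Suc n)) (SIGMA i:corners r. tableaux n (remove_cell r i))
           (tableaux (Suc n) r)"
proof (rule bij_betwI')
  let ?f = "\<lambda>(i, T). T((i, r i - 1) := Suc n)"
  fix x y assume x: "x \<in> (SIGMA i:corners r. tableaux n (remove_cell r i))"
    and y: "y \<in> (SIGMA i:corners r. tableaux n (remove_cell r i))"
  obtain i T i' T' where xy: "x = (i, T)" "y = (i', T')" by fastforce
  have T: "i \<in> corners r" "i' \<in> corners r" "T \<in> tableaux n (remove_cell r i)" "T' \<in> tableaux n (remove_cell r i')"
    using x y xy by auto
  show "(?f x = ?f y) = (x = y)"
  proof
    assume eq: "?f x = ?f y"
    have "i = i'"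
    proof (rule ccontr)
      assume ne: "i \<noteq> i'"
      have "(i, r i - 1) \<in> cells r" using cells_remove_cell(1)[OF T(1)] by auto
      hence "(i, r i - 1) \<in> cells (remove_cell r i')" using cells_remove_cell(1)[OF T(2)] ne by auto
      hence "T' (i, r i - 1) \<le> n" using T(4) unfolding tableaux_def bij_betw_def by auto
      moreover have "T' (i, r i - 1) = Suc n" using fun_cong[OF eq, of "(i, r i - 1)"] ne xy by auto
      ultimately show False by simp
    qed
    moreover have "T = T'"
    proof (rule extensionalityI)
      show "T \<in> extensional (cells (remove_cell r i))" "T' \<in> extensional (cells (remove_cell r i))"
        using T \<open>i = i'\<close> by (auto simp: tableaux_def)
      fix c assume c: "c \<in> cells (remove_cell r i)"
      hence "c \<noteq> (i, r i - 1)" using cells_remove_cell(2)[OF T(1)] by auto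
      thus "T c = T' c" using fun_cong[OF eq, of c] xy \<open>i = i'\<close> by auto
    qed
    ultimately show "x = y" using xy by simp
  qed auto
next
  let ?f = "\<lambda>(i, T). T((i, r i - 1) := Suc n)"
  fix x assume x: "x \<in> (SIGMA i:corners r. tableaux n (remove_cell r i))"
  obtain i T where xT: "x = (i, T)" by fastforce
  define c where "c = (i, r i - 1)"
  define s where "s = remove_cell r i"
  have i: "i \<in> corners r" and T: "T \<in> tableaux n s" using x xT by (auto simp: s_def)
  have cr: "cells r = insert c (cells s)" and cs: "c \<notin> cells s"
    using cells_remove_cell[OF i] by (auto simp: c_def s_def)
  have bij: "bij_betw T (cells s) {1..n}" and ext: "T \<in> extensional (cells s)"
    and row: "\<And>i j j'. (i, j) \<in> cells s \<Longrightarrow> (i, j') \<in> cells s \<Longrightarrow> j < j' \<Longrightarrow> T (i, j) < T (i, j')"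
    and col: "\<And>i i' j. (i, j) \<in> cells s \<Longrightarrow> (i', j) \<in> cells s \<Longrightarrow> i < i' \<Longrightarrow> T (i, j) < T (i', j)"
    using T unfolding tableaux_def by blast+
  have le: "T e < Suc n" if "e \<in> cells s" for e using bij_betwE[OF bij] that by force
  have "bij_betw (T(c := Suc n)) (cells r) {1..Suc n}"
  proof -
    have "bij_betw (T(c := Suc n)) (cells s) {1..n}"
      using bij cs by (subst bij_betw_cong[of _ _ T]) auto
    hence "bij_betw (T(c := Suc n)) (cells s \<union> {c}) ({1..n} \<union> {(T(c := Suc n)) c})"
      using cs by (subst notIn_Un_bij_betw3[symmetric]) auto
    moreover have "{1..n} \<union> {Suc n} = {1..Suc n}" by auto
    ultimately show ?thesis by (simp add: cr)
  qed
  moreover have "(T(c := Suc n)) (a, j) < (T(c := Suc n)) (a, j')"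
    if "(a, j) \<in> cells r" "(a, j') \<in> cells r" "j < j'" for a j j'
  proof -
    have "(a, j) \<noteq> c" using that by (auto simp: c_def cells_def)
    thus ?thesis using that row[of a j j'] le[of "(a, j)"] by (auto simp: cr)
  qed
  moreover have "(T(c := Suc n)) (a, j) < (T(c := Suc n)) (a', j)"
    if "(a, j) \<in> cells r" "(a', j) \<in> cells r" "a < a'" for a a' j
  proof -
    \<comment> \<open>The row below a corner is too short to reach its column, so the new cell is
      never the upper one of two cells in a column.\<close>
    have "(a, j) \<noteq> c"
    proof
      assume "(a, j) = c"
      hence "r (Suc i) > r i - 1" "r (Suc i) < r i" using that i shapeD[OF assms, of "Suc i" a']
        by (auto simp: c_def cells_def corners_def)
      thus False by simp
    qed
    thus ?thesis using that col[of a j a'] le[of "(a, j)"] by (auto simp: cr)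
  qed
  moreover have "T(c := Suc n) \<in> extensional (cells r)"
    using ext by (auto simp: extensional_def cr)
  ultimately show "?f x \<in> tableaux (Suc n) r" unfolding tableaux_def xT by (auto simp: c_def)
next
  let ?f = "\<lambda>(i, T). T((i, r i - 1) := Suc n)"
  fix T assume T: "T \<in> tableaux (Suc n) r"
  have bij: "bij_betw T (cells r) {1..Suc n}" and ext: "T \<in> extensional (cells r)"
    and row: "\<And>i j j'. (i, j) \<in> cells r \<Longrightarrow> (i, j') \<in> cells r \<Longrightarrow> j < j' \<Longrightarrow> T (i, j) < T (i, j')"
    and col: "\<And>i i' j. (i, j) \<in> cells r \<Longrightarrow> (i', j) \<in> cells r \<Longrightarrow> i < i' \<Longrightarrow> T (i, j) < T (i', j)"
    using T unfolding tableaux_def by blast+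
  have le: "T e \<le> Suc n" if "e \<in> cells r" for e using bij_betwE[OF bij] that by force
  have "Suc n \<in> T ` cells r" using bij by (simp add: bij_betw_def)
  then obtain i j where ij: "(i, j) \<in> cells r" "T (i, j) = Suc n" by auto
  have "\<not> Suc j < r i"
  proof
    assume "Suc j < r i"
    hence "(i, Suc j) \<in> cells r" by (simp add: cells_def)
    from row[OF ij(1) this] le[OF this] ij(2) show False by simp
  qed
  hence j: "j = r i - 1" using ij by (simp add: cells_def)
  have "\<not> j < r (Suc i)"
  proof
    assume "j < r (Suc i)"
    hence "(Suc i, j) \<in> cells r" by (simp add: cells_def)
    from col[OF ij(1) this] le[OF this] ij(2) show False by simp
  qed
  hence i: "i \<in> corners r" using ij by (simp add: cells_def corners_def)
  define s where "s = remove_cell r i"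
  have cr: "cells r = insert (i, j) (cells s)" and cs: "(i, j) \<notin> cells s"
    using cells_remove_cell[OF i] by (auto simp: j s_def)
  define S where "S = restrict T (cells s)"
  have "bij_betw S (cells s) {1..n}"
  proof -
    have "bij_betw T (cells r - {(i, j)}) ({1..Suc n} - {T (i, j)})"
      by (intro bij_betw_DiffI bij) (use ij in \<open>auto simp: bij_betw_def\<close>)
    moreover have "cells r - {(i, j)} = cells s" "{1..Suc n} - {T (i, j)} = {1..n}"
      using cs ij by (auto simp: cr)
    ultimately show ?thesis by (simp add: S_def bij_betw_cong[of _ "restrict T (cells s)" T])
  qed
  hence "S \<in> tableaux n s"
    unfolding tableaux_def S_def using row col by (auto simp: cr)
  moreover have "T = S((i, j) := Suc n)"
  proof
    fix e show "T e = (S((i, j) := Suc n)) e"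
      using ij ext by (cases e) (auto simp: S_def cr extensional_def)
  qed
  ultimately show "\<exists>x\<in>SIGMA i:corners r. tableaux n (remove_cell r i). T = ?f x"
    using i by (intro bexI[of _ "(i, S)"]) (auto simp: j s_def)
qed

lemma card_tableaux:
  assumes "shape d r"
  shows "finite (tableaux n r) \<and> card (tableaux n r) = num_chains n r"
  using assms
proof (induction n arbitrary: r)
  case (Suc n)
  have IH: "finite (tableaux n (remove_cell r i))" "card (tableaux n (remove_cell r i)) = num_chains n (remove_cell r i)"
    if "i \<in> corners r" for i
    using Suc.IH[OF shape_remove_cell[OF Suc.prems that]] by auto
  have fin: "finite (SIGMA i:corners r. tableaux n (remove_cell r i))"
    using IH finite_corners[OF Suc.prems] by auto
  note bij = bij_betw_add_max_cell[OF Suc.prems, of n]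
  show ?case
    using bij_betw_same_card[OF bij] bij_betw_finite[OF bij] fin IH finite_corners[OF Suc.prems] by simp
qed (auto simp: tableaux_0)

definition rect_shape :: "nat \<Rightarrow> nat \<Rightarrow> nat \<Rightarrow> nat" where
  "rect_shape d q i = (if i < d then q else 0)"

lemma shape_rect_shape: "shape d (rect_shape d q)"
  by (rule shapeI) (auto simp: rect_shape_def)

lemma dim_rect_diagram: "dim_diagram (rect_diagram d q) = num_chains (d * q) (rect_shape d q)"
proof -
  have "diagram_cells (rect_diagram d q) = cells (rect_shape d q)"
    by (auto simp: diagram_cells_def rect_diagram_def cells_def rect_shape_def split: if_splits)
  moreover have "sum_list (rect_diagram d q) = d * q"
    by (simp add: rect_diagram_def sum_list_replicate)
  ultimately have "standard_tableaux (rect_diagram d q) = tableaux (d * q) (rect_shape d q)"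
    by (simp add: standard_tableaux_def tableaux_def)
  thus ?thesis using card_tableaux[OF shape_rect_shape] by (simp add: dim_diagram_def)
qed

section \<open>Cutting a rectangle into two complementary shapes\<close>

text \<open>The bound on \<open>r 0\<close> bounds every row, which keeps the natural number
  subtraction in \<open>compl_shape\<close> exact and complementation involutive.\<close>

definition box_shapes :: "nat \<Rightarrow> nat \<Rightarrow> nat \<Rightarrow> (nat \<Rightarrow> nat) set" where
  "box_shapes d q k = {r. shape d r \<and> r 0 \<le> q \<and> sum r {..<d} = k}"

definition compl_shape :: "nat \<Rightarrow> nat \<Rightarrow> (nat \<Rightarrow> nat) \<Rightarrow> nat \<Rightarrow> nat" where
  "compl_shape d q r i = (if i < d then q - r (d - 1 - i) else 0)"

lemma box_shapes_le: "r \<in> box_shapes d q k \<Longrightarrow> r i \<le> q"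
  using shapeD[of d r 0 i] by (auto simp: box_shapes_def)

lemma finite_box_shapes: "finite (box_shapes d q k)"
proof (rule finite_subset)
  show "box_shapes d q k \<subseteq> {f. \<forall>x. (x \<in> {..<d} \<longrightarrow> f x \<in> {..q}) \<and> (x \<notin> {..<d} \<longrightarrow> f x = 0)}"
    using box_shapes_le by (auto simp: box_shapes_def shape_ge not_less)
qed (rule finite_set_of_finite_funs, auto)

lemma compl_shape_in_box:
  assumes "r \<in> box_shapes d q k"
  shows "compl_shape d q r \<in> box_shapes d q (d * q - k)"
proof -
  have sh: "shape d r" using assms by (simp add: box_shapes_def)
  have "shape d (compl_shape d q r)"
    by (rule shapeI) (auto simp: compl_shape_def intro!: diff_le_mono2 shapeD[OF sh])
  moreover have "sum (compl_shape d q r) {..<d} = d * q - k"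
  proof -
    have "sum (compl_shape d q r) {..<d} = (\<Sum>i<d. q - r (d - 1 - i))"
      by (simp add: compl_shape_def)
    also have "\<dots> = (\<Sum>i<d. q - r i)"
      by (rule sum.reindex_bij_witness[of _ "\<lambda>j. d - 1 - j" "\<lambda>j. d - 1 - j"]) auto
    also have "\<dots> = d * q - k"
      using assms box_shapes_le[OF assms] by (subst sum_subtractf_nat) (auto simp: box_shapes_def)
    finally show ?thesis .
  qed
  ultimately show ?thesis by (auto simp: box_shapes_def compl_shape_def)
qed

lemma compl_compl_shape:
  assumes "r \<in> box_shapes d q k"
  shows "compl_shape d q (compl_shape d q r) = r"
  using assms box_shapes_le[OF assms] by (auto simp: compl_shape_def fun_eq_iff box_shapes_def shape_ge not_less)

lemma remove_cell_in_box:
  assumes "r \<in> box_shapes d q (Suc k)" "i \<in> corners r"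
  shows "remove_cell r i \<in> box_shapes d q k"
  using assms sum_remove_cell[of d r i] shape_remove_cell[of d r i] by (auto simp: box_shapes_def remove_cell_def)

text \<open>A cell taken from row \<open>i\<close> of \<open>r\<close> joins the complement, where
  the rotation puts it at the end of row \<open>d - 1 - i\<close>.\<close>

lemma corner_compl_remove_cell:
  assumes r: "r \<in> box_shapes d q k" and i: "i \<in> corners r"
  defines "s \<equiv> compl_shape d q (remove_cell r i)"
  shows "d - 1 - i \<in> corners s" and "remove_cell s (d - 1 - i) = compl_shape d q r"
proof -
  have sh: "shape d r" using r by (simp add: box_shapes_def)
  have id: "i < d" using corners_subset[OF sh] i by auto
  have ri: "0 < r i" using i by (simp add: corners_def)
  note le = box_shapes_le[OF r]
  have si: "s (d - 1 - i) = Suc (q - r i)"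
    using id ri le[of i] by (auto simp: s_def compl_shape_def remove_cell_def)
  have eq: "d - Suc x = i \<longleftrightarrow> x = d - Suc i" if "x < d" for x using id that by auto
  show "remove_cell s (d - 1 - i) = compl_shape d q r"
  proof
    fix x show "remove_cell s (d - 1 - i) x = compl_shape d q r x"
      using si id by (cases "x < d") (auto simp: remove_cell_def compl_shape_def s_def eq)
  qed
  \<comment> \<open>The row after \<open>d - 1 - i\<close> comes from row \<open>i - 1\<close> of
    \<open>r\<close>, which is at least as long as row \<open>i\<close>; for \<open>i = 0\<close> it
    lies outside the box and is empty.\<close>
  have "s (Suc (d - 1 - i)) < Suc (q - r i)"
  proof (cases "i = 0")
    case False
    have e2: "d - Suc (Suc (d - Suc i)) = i - 1" using id False by simp
    have "s (Suc (d - 1 - i)) = q - r (i - 1)"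
      using id e2 False by (auto simp: s_def compl_shape_def remove_cell_def)
    also have "\<dots> \<le> q - r i" using shapeD[OF sh, of "i - 1" i] by (intro diff_le_mono2) simp
    finally show ?thesis by simp
  qed (use id in \<open>auto simp: s_def compl_shape_def\<close>)
  thus "d - 1 - i \<in> corners s" unfolding corners_def by (simp only: mem_Collect_eq si)
qed

text \<open>Raising the cut from \<open>k\<close> to \<open>k + 1\<close> does not change the sum,
  because both sums run over the edges of Young's lattice between the two levels of the box. An edge
  is given either by its upper end and a corner of it, or by its lower end and a corner of the
  complement of the lower end.\<close>

lemma num_chains_rect_split:
  assumes "k \<le> d * q"
  shows "num_chains (d * q) (rect_shape d q) =
    (\<Sum>r\<in>box_shapes d q k. num_chains k r * num_chains (d * q - k) (compl_shape d q r))"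
  using assms
proof (induction k)
  case 0
  have "r = (\<lambda>_. 0)" if "r \<in> box_shapes d q 0" for r
  proof
    fix i show "r i = 0" using that by (cases "i < d") (auto simp: box_shapes_def shape_ge)
  qed
  hence "box_shapes d q 0 = {\<lambda>_. 0}"
    by (auto simp: box_shapes_def shape_def antimono_def)
  moreover have "compl_shape d q (\<lambda>_. 0) = rect_shape d q"
    by (simp add: compl_shape_def rect_shape_def fun_eq_iff)
  ultimately show ?case by simp
next
  case (Suc k)
  let ?c = "num_chains"
  let ?K = "d * q - Suc k"
  define C where "C = compl_shape d q"
  have K: "d * q - k = Suc ?K" using Suc.prems by simp
  have fin: "finite (corners r)" if "r \<in> box_shapes d q k'" for r k'
    using that finite_corners by (auto simp: box_shapes_def)
  have Cbox: "C s \<in> box_shapes d q (Suc ?K)" if "s \<in> box_shapes d q k" for s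
    using compl_shape_in_box[OF that] K by (simp add: C_def)
  have CboxS: "C r \<in> box_shapes d q ?K" if "r \<in> box_shapes d q (Suc k)" for r
    using compl_shape_in_box[OF that] by (simp add: C_def)
  have d1: "d - Suc (d - Suc i) = i" if "i \<in> corners r" "r \<in> box_shapes d q k'" for i r k'
    using corners_subset[of d r] that by (force simp: box_shapes_def)
  have "(\<Sum>r\<in>box_shapes d q (Suc k). ?c (Suc k) r * ?c ?K (C r)) =
        (\<Sum>r\<in>box_shapes d q (Suc k). \<Sum>i\<in>corners r. ?c k (remove_cell r i) * ?c ?K (C r))"
    by (simp add: sum_distrib_right)
  also have "\<dots> = (\<Sum>(r, i)\<in>(SIGMA r:box_shapes d q (Suc k). corners r). ?c k (remove_cell r i) * ?c ?K (C r))"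
    by (rule sum.Sigma) (auto simp: finite_box_shapes fin)
  also have "\<dots> = (\<Sum>(s, j)\<in>(SIGMA s:box_shapes d q k. corners (C s)). ?c k s * ?c ?K (remove_cell (C s) j))"
  proof (rule sum.reindex_bij_witness[of _ "\<lambda>(s, j). (C (remove_cell (C s) j), d - 1 - j)"
        "\<lambda>(r, i). (remove_cell r i, d - 1 - i)"])
    fix x assume "x \<in> (SIGMA r:box_shapes d q (Suc k). corners r)"
    then obtain r i where x: "x = (r, i)" and r: "r \<in> box_shapes d q (Suc k)" and i: "i \<in> corners r" by auto
    note * = corner_compl_remove_cell[OF r i, folded C_def]
    show "(case case x of (r, i) \<Rightarrow> (remove_cell r i, d - 1 - i) of
        (s, j) \<Rightarrow> (C (remove_cell (C s) j), d - 1 - j)) = x"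
      using *(2) compl_compl_shape[OF r] d1[OF i r] by (simp add: x C_def)
    show "(case x of (r, i) \<Rightarrow> (remove_cell r i, d - 1 - i)) \<in> (SIGMA s:box_shapes d q k. corners (C s))"
      using *(1) remove_cell_in_box[OF r i] by (simp add: x)
    show "(case case x of (r, i) \<Rightarrow> (remove_cell r i, d - 1 - i) of
        (s, j) \<Rightarrow> ?c k s * ?c ?K (remove_cell (C s) j)) =
        (case x of (r, i) \<Rightarrow> ?c k (remove_cell r i) * ?c ?K (C r))"
      using *(2) by (simp add: x)
  next
    fix y assume "y \<in> (SIGMA s:box_shapes d q k. corners (C s))"
    then obtain s j where y: "y = (s, j)" and s: "s \<in> box_shapes d q k" and j: "j \<in> corners (C s)" by auto
    note * = corner_compl_remove_cell[OF Cbox[OF s] j, folded C_def]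
    have CC: "C (C s) = s" using compl_compl_shape[OF s] by (simp add: C_def)
    have rem: "remove_cell (C s) j \<in> box_shapes d q ?K" by (rule remove_cell_in_box[OF Cbox[OF s] j])
    show "(case case y of (s, j) \<Rightarrow> (C (remove_cell (C s) j), d - 1 - j) of
       (r, i) \<Rightarrow> (remove_cell r i, d - 1 - i)) = y"
      using *(2) d1[OF j Cbox[OF s]] CC by (simp add: y)
    have "C (remove_cell (C s) j) \<in> box_shapes d q (Suc k)"
      using compl_shape_in_box[OF rem] Suc.prems by (simp add: C_def)
    thus "(case y of (s, j) \<Rightarrow> (C (remove_cell (C s) j), d - 1 - j)) \<in> (SIGMA r:box_shapes d q (Suc k). corners r)"
      using *(1) by (simp add: y)
  qed
  also have "\<dots> = (\<Sum>s\<in>box_shapes d q k. \<Sum>j\<in>corners (C s). ?c k s * ?c ?K (remove_cell (C s) j))"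
    by (rule sum.Sigma[symmetric]) (auto simp: finite_box_shapes intro: fin Cbox)
  also have "\<dots> = (\<Sum>s\<in>box_shapes d q k. ?c k s * ?c (d * q - k) (C s))"
    unfolding K by (simp add: sum_distrib_left)
  finally show ?case using Suc by (simp add: C_def)
qed

section \<open>Local growth rules\<close>

definition is_shape :: "(nat \<Rightarrow> nat) \<Rightarrow> bool" where
  "is_shape r \<longleftrightarrow> (\<exists>d. shape d r)"

definition add_cell :: "(nat \<Rightarrow> nat) \<Rightarrow> nat \<Rightarrow> nat \<Rightarrow> nat" where
  "add_cell r i = r(i := Suc (r i))"

definition grows :: "(nat \<Rightarrow> nat) \<Rightarrow> (nat \<Rightarrow> nat) \<Rightarrow> bool" where
  "grows r s \<longleftrightarrow> s = r \<or> (\<exists>i. s = add_cell r i)"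

text \<open>In \<open>local_rule\<close> the row found has length exactly \<open>c\<close>, so the
  new cell goes to the foot of column \<open>c\<close>, counted from 0. With \<open>c = 0\<close> it
  opens a new row.\<close>

definition bump :: "(nat \<Rightarrow> nat) \<Rightarrow> nat \<Rightarrow> nat \<Rightarrow> nat" where
  "bump r c = add_cell r (LEAST i. r i \<le> c)"

definition changed_row :: "(nat \<Rightarrow> nat) \<Rightarrow> (nat \<Rightarrow> nat) \<Rightarrow> nat" where
  "changed_row r s = (THE i. r i \<noteq> s i)"

text \<open>
  Fomin's local rules in the form corresponding to column insertion: a cross in a square of the diagram
  adds a new row. Hence the number of rows obeys the recursion for the length of the longest
  increasing sequence of crosses, and no separate proof of Schensted's theorem is needed.
\<close>

definition local_rule :: "bool \<Rightarrow> (nat \<Rightarrow> nat) \<Rightarrow> (nat \<Rightarrow> nat) \<Rightarrow> (nat \<Rightarrow> nat) \<Rightarrow> nat \<Rightarrow> nat" where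
  "local_rule x \<rho> \<mu> \<nu> =
     (if x then bump \<rho> 0
      else if \<mu> \<noteq> \<nu> then (\<lambda>i. max (\<mu> i) (\<nu> i))
      else if \<mu> = \<rho> then \<rho>
      else bump \<mu> (\<mu> (changed_row \<rho> \<mu>)))"

text \<open>In the last case \<open>c\<close> is the column, counted from 0, of the cell by which
  \<open>\<kappa>\<close> exceeds \<open>\<mu>\<close>. Column 0 is reached only through a cross;
  otherwise the cell added from \<open>\<rho>\<close> to \<open>\<mu>\<close> was the foot of the
  preceding column, found in the last row of length at least \<open>c\<close>.\<close>

definition inverse_rule :: "(nat \<Rightarrow> nat) \<Rightarrow> (nat \<Rightarrow> nat) \<Rightarrow> (nat \<Rightarrow> nat) \<Rightarrow> (nat \<Rightarrow> nat) \<times> bool" where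
  "inverse_rule \<mu> \<nu> \<kappa> =
     (if \<mu> \<noteq> \<nu> then (\<lambda>i. min (\<mu> i) (\<nu> i), False)
      else if \<mu> = \<kappa> then (\<mu>, False)
      else let c = \<mu> (changed_row \<mu> \<kappa>)
           in if c = 0 then (\<mu>, True) else (remove_cell \<mu> (GREATEST i. c \<le> \<mu> i), False))"

lemma add_cell_neq [simp]: "add_cell r i \<noteq> r" "r \<noteq> add_cell r i"
  by (auto simp: add_cell_def fun_eq_iff)

lemma add_cell_eq_iff [simp]: "add_cell r i = add_cell r j \<longleftrightarrow> i = j"
  by (auto simp: add_cell_def fun_eq_iff split: if_splits)

lemma grows_add_cell: "s = add_cell r i \<Longrightarrow> grows r s \<and> r \<noteq> s"
  by (auto simp: grows_def)

lemma changed_row_add_cell [simp]: "changed_row r (add_cell r i) = i"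
  unfolding changed_row_def by (rule the_equality) (auto simp: add_cell_def split: if_splits)

lemma remove_add_cell [simp]: "remove_cell (add_cell r i) i = r"
  by (auto simp: remove_cell_def add_cell_def)

lemma add_remove_cell: "0 < r i \<Longrightarrow> add_cell (remove_cell r i) i = r"
  by (auto simp: remove_cell_def add_cell_def)

lemma is_shape_iff: "is_shape r \<longleftrightarrow> (\<forall>i. r (Suc i) \<le> r i) \<and> (\<exists>d. r d = 0)"
proof
  assume "is_shape r"
  thus "(\<forall>i. r (Suc i) \<le> r i) \<and> (\<exists>d. r d = 0)"
    using shapeD[of _ r] by (auto simp: is_shape_def shape_def)
next
  assume "(\<forall>i. r (Suc i) \<le> r i) \<and> (\<exists>d. r d = 0)"
  thus "is_shape r" using shapeI[of r] by (auto simp: is_shape_def)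
qed

lemma is_shapeD: "is_shape r \<Longrightarrow> i \<le> j \<Longrightarrow> r j \<le> r i"
  by (auto simp: is_shape_def dest: shapeD)

lemma is_shape_max: "is_shape r \<Longrightarrow> is_shape s \<Longrightarrow> is_shape (\<lambda>i. max (r i) (s i))"
proof -
  assume *: "is_shape r" "is_shape s"
  then obtain d e where "shape d r" "shape e s" by (auto simp: is_shape_def)
  hence "max (r (max d e)) (s (max d e)) = 0" by (simp add: shape_ge)
  moreover have "max (r (Suc i)) (s (Suc i)) \<le> max (r i) (s i)" for i
    using * by (intro max.mono) (auto simp: is_shape_iff)
  ultimately show ?thesis unfolding is_shape_iff by blast
qed

lemma is_shape_min: "is_shape r \<Longrightarrow> is_shape s \<Longrightarrow> is_shape (\<lambda>i. min (r i) (s i))"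
proof -
  assume *: "is_shape r" "is_shape s"
  then obtain d where "shape d r" by (auto simp: is_shape_def)
  hence "min (r d) (s d) = 0" by (simp add: shape_ge)
  moreover have "min (r (Suc i)) (s (Suc i)) \<le> min (r i) (s i)" for i
    using * by (intro min.mono) (auto simp: is_shape_iff)
  ultimately show ?thesis unfolding is_shape_iff by blast
qed

lemma is_shape_bump:
  assumes "is_shape r"
  shows "is_shape (bump r c)"
proof -
  define k where "k = (LEAST i. r i \<le> c)"
  obtain e where e: "shape e r" using assms by (auto simp: is_shape_def)
  have k: "r k \<le> c" unfolding k_def by (rule LeastI[of _ e]) (use e in \<open>simp add: shape_def\<close>)
  have less: "c < r i" if "i < k" for i using not_less_Least[of i "\<lambda>i. r i \<le> c"] that unfolding k_def by auto
  have "add_cell r k (Suc i) \<le> add_cell r k i" for i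
    using k less[of i] is_shapeD[OF assms, of i "Suc i"] by (auto simp: add_cell_def)
  moreover have "add_cell r k (max e (Suc k)) = 0"
    using e by (auto simp: add_cell_def shape_ge)
  ultimately show ?thesis by (auto simp: is_shape_iff bump_def k_def)
qed

lemma grows_bump: "grows r (bump r c)"
  by (auto simp: grows_def bump_def)

text \<open>If a cell may be added to row \<open>k\<close>, all rows above are strictly longer.
  Hence \<open>bump\<close> reproduces a given \<open>\<kappa>\<close> when squares are filled
  backwards.\<close>

lemma Least_bump_new:
  assumes "is_shape r" "is_shape (add_cell r k)"
  shows "(LEAST i. r i \<le> r k) = k"
proof (rule Least_equality)
  fix i assume i: "r i \<le> r k"
  show "k \<le> i"
  proof (rule ccontr)
    assume "\<not> k \<le> i"
    hence "add_cell r k k \<le> add_cell r k i" by (intro is_shapeD[OF assms(2)]) simp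
    thus False using \<open>\<not> k \<le> i\<close> i by (simp add: add_cell_def)
  qed
qed simp

lemma Least_row:
  assumes "is_shape r"
  shows "r (LEAST i. r i \<le> r k) = r k"
proof (rule antisym)
  show "r (LEAST i. r i \<le> r k) \<le> r k" by (rule LeastI[of _ k]) simp
  show "r k \<le> r (LEAST i. r i \<le> r k)" by (rule is_shapeD[OF assms]) (simp add: Least_le)
qed

lemma Least_empty_row:
  assumes "is_shape r"
  shows "r (LEAST i. r i \<le> 0) = 0"
proof -
  obtain e where "shape e r" using assms by (auto simp: is_shape_def)
  thus ?thesis using LeastI[of "\<lambda>i. r i \<le> 0" e] by (simp add: shape_def)
qed

lemma Greatest_row:
  assumes "is_shape r" "0 < r k"
  defines "g \<equiv> (GREATEST i. r k \<le> r i)"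
  shows "r g = r k" "k \<le> g" "r (Suc g) < r g"
proof -
  obtain e where e: "shape e r" using assms by (auto simp: is_shape_def)
  have bound: "\<forall>i. r k \<le> r i \<longrightarrow> i \<le> e"
    using assms(2) shape_ge[OF e] by (metis le_zero_eq nat_le_linear not_gr_zero)
  have g: "r k \<le> r g" unfolding g_def by (rule GreatestI_nat[of _ k e]) (use bound in auto)
  show kg: "k \<le> g" unfolding g_def by (rule Greatest_le_nat[of _ k e]) (use bound in auto)
  show "r g = r k" using is_shapeD[OF assms(1) kg] g by simp
  show "r (Suc g) < r g"
  proof (rule ccontr)
    assume "\<not> r (Suc g) < r g"
    hence "Suc g \<le> g" unfolding g_def
      by (intro Greatest_le_nat[of _ _ e]) (use bound g in \<open>auto simp: g_def\<close>)
    thus False by simp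
  qed
qed

lemma Greatest_row_add_cell:
  assumes "is_shape r"
  shows "(GREATEST j. Suc (r i) \<le> add_cell r i j) = i"
proof (rule Greatest_equality)
  fix j assume "Suc (r i) \<le> add_cell r i j"
  thus "j \<le> i" using is_shapeD[OF assms, of i j] by (cases "j \<le> i") (auto simp: add_cell_def split: if_splits)
qed (simp add: add_cell_def)

lemma add_cell_max:
  "i \<noteq> j \<Longrightarrow> (\<lambda>k. max (add_cell r i k) (add_cell r j k)) = add_cell (add_cell r i) j"
  "(\<lambda>k. max (add_cell r i k) (r k)) = add_cell r i"
  "(\<lambda>k. max (r k) (add_cell r i k)) = add_cell r i"
  "i \<noteq> j \<Longrightarrow> (\<lambda>k. min (add_cell r i k) (add_cell r j k)) = r"
  "(\<lambda>k. min (add_cell r i k) (r k)) = r"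
  "(\<lambda>k. min (r k) (add_cell r i k)) = r"
  by (auto simp: add_cell_def fun_eq_iff)

lemma add_cell_commute: "add_cell (add_cell r i) j = add_cell (add_cell r j) i"
  by (auto simp: add_cell_def fun_eq_iff)

text \<open>Call a side of the unit square trivial if its two shapes agree. The equivalences say
  that opposite sides are trivial together, except that a cross has trivial sides at
  \<open>\<rho>\<close> and nontrivial ones at \<open>\<kappa>\<close>; in this way a growth diagram
  remembers where its crosses are.\<close>

lemma local_rule_forward:
  assumes shape: "is_shape \<rho>" "is_shape \<mu>" "is_shape \<nu>"
    and grows: "grows \<rho> \<mu>" "grows \<rho> \<nu>" and x: "x \<Longrightarrow> \<mu> = \<rho> \<and> \<nu> = \<rho>"
  defines "\<kappa> \<equiv> local_rule x \<rho> \<mu> \<nu>"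
  shows "is_shape \<kappa>" "grows \<mu> \<kappa>" "grows \<nu> \<kappa>"
    "\<mu> = \<kappa> \<longleftrightarrow> \<rho> = \<nu> \<and> \<not> x" "\<nu> = \<kappa> \<longleftrightarrow> \<rho> = \<mu> \<and> \<not> x"
    "inverse_rule \<mu> \<nu> \<kappa> = (\<rho>, x)"
proof -
  show "is_shape \<kappa>"
    unfolding \<kappa>_def local_rule_def using shape by (auto intro: is_shape_bump is_shape_max)
  consider "x" "\<mu> = \<rho>" "\<nu> = \<rho>" | "\<not> x" "\<mu> = \<rho>" "\<nu> = \<rho>"
    | i where "\<not> x" "\<mu> = add_cell \<rho> i" "\<nu> = \<rho>" | i where "\<not> x" "\<nu> = add_cell \<rho> i" "\<mu> = \<rho>"
    | i where "\<not> x" "\<nu> = add_cell \<rho> i" "\<mu> = \<nu>"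
    | i j where "\<not> x" "\<mu> = add_cell \<rho> i" "\<nu> = add_cell \<rho> j" "i \<noteq> j"
    using grows x unfolding grows_def by metis
  hence "grows \<mu> \<kappa> \<and> grows \<nu> \<kappa> \<and> (\<mu> = \<kappa> \<longleftrightarrow> \<rho> = \<nu> \<and> \<not> x) \<and> (\<nu> = \<kappa> \<longleftrightarrow> \<rho> = \<mu> \<and> \<not> x) \<and>
    inverse_rule \<mu> \<nu> \<kappa> = (\<rho>, x)"
  proof cases
    case 1
    thus ?thesis using Least_empty_row[OF shape(1)]
      by (simp add: \<kappa>_def local_rule_def inverse_rule_def grows_bump) (simp add: bump_def)
  next
    case (5 i)
    \<comment> \<open>The row that \<open>bump\<close> lengthens has positive length, so
      \<open>inverse_rule\<close> does not mistake this case for a cross.\<close>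
    have *: "\<mu> (LEAST j. \<mu> j \<le> \<mu> i) = Suc (\<rho> i)"
      using Least_row[OF shape(2), of i] 5 by (simp add: add_cell_def)
    have "\<kappa> = bump \<mu> (\<mu> i)" using 5 by (simp add: \<kappa>_def local_rule_def)
    moreover have "inverse_rule \<mu> \<nu> \<kappa> = (\<rho>, False)"
      using * Greatest_row_add_cell[OF shape(1), of i] 5 \<open>\<kappa> = bump \<mu> (\<mu> i)\<close>
      by (simp add: inverse_rule_def bump_def)
    ultimately show ?thesis using 5 by (auto simp: grows_bump) (auto simp: bump_def)
  next
    case (6 i j)
    have "\<mu> \<noteq> \<nu>" using 6 by simp
    hence 1: "\<kappa> = add_cell \<mu> j" using 6 by (simp add: \<kappa>_def local_rule_def add_cell_max)
    have 2: "\<kappa> = add_cell \<nu> i" using 6 by (simp add: 1 add_cell_commute)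
    have "inverse_rule \<mu> \<nu> \<kappa> = (\<rho>, False)"
      using \<open>\<mu> \<noteq> \<nu>\<close> 6 by (simp add: inverse_rule_def add_cell_max)
    moreover have "\<mu> \<noteq> \<rho>" "\<nu> \<noteq> \<rho>" using 6 by simp_all
    ultimately show ?thesis using 6(1) grows_add_cell[OF 1] grows_add_cell[OF 2] by simp
  qed (auto simp: \<kappa>_def local_rule_def inverse_rule_def grows_def add_cell_max)
  thus "grows \<mu> \<kappa>" "grows \<nu> \<kappa>" "\<mu> = \<kappa> \<longleftrightarrow> \<rho> = \<nu> \<and> \<not> x" "\<nu> = \<kappa> \<longleftrightarrow> \<rho> = \<mu> \<and> \<not> x"
    "inverse_rule \<mu> \<nu> \<kappa> = (\<rho>, x)" by blast+
qed

text \<open>The mirror image of the forward statement, starting from arbitrary growing far sides.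
  Surjectivity needs it, where no matrix is given in advance.\<close>

lemma local_rule_backward:
  assumes shape: "is_shape \<mu>" "is_shape \<nu>" "is_shape \<kappa>"
    and grows: "grows \<mu> \<kappa>" "grows \<nu> \<kappa>" and inv: "inverse_rule \<mu> \<nu> \<kappa> = (\<rho>, x)"
  shows "is_shape \<rho>" "grows \<rho> \<mu>" "grows \<rho> \<nu>" "x \<Longrightarrow> \<mu> \<noteq> \<kappa> \<and> \<nu> \<noteq> \<kappa>"
    "\<rho> = \<mu> \<longleftrightarrow> \<nu> = \<kappa> \<or> x" "\<rho> = \<nu> \<longleftrightarrow> \<mu> = \<kappa> \<or> x"
    "local_rule x \<rho> \<mu> \<nu> = \<kappa>"
proof -
  consider "\<mu> = \<kappa>" "\<nu> = \<kappa>" | i where "\<mu> = \<kappa>" "\<kappa> = add_cell \<nu> i" | i where "\<nu> = \<kappa>" "\<kappa> = add_cell \<mu> i"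
    | i where "\<kappa> = add_cell \<mu> i" "\<mu> = \<nu>"
    | i j where "\<kappa> = add_cell \<mu> i" "\<kappa> = add_cell \<nu> j" "i \<noteq> j"
  proof -
    assume that: "\<mu> = \<kappa> \<Longrightarrow> \<nu> = \<kappa> \<Longrightarrow> thesis" "\<And>i. \<mu> = \<kappa> \<Longrightarrow> \<kappa> = add_cell \<nu> i \<Longrightarrow> thesis"
      "\<And>i. \<nu> = \<kappa> \<Longrightarrow> \<kappa> = add_cell \<mu> i \<Longrightarrow> thesis" "\<And>i. \<kappa> = add_cell \<mu> i \<Longrightarrow> \<mu> = \<nu> \<Longrightarrow> thesis"
      "\<And>i j. \<kappa> = add_cell \<mu> i \<Longrightarrow> \<kappa> = add_cell \<nu> j \<Longrightarrow> i \<noteq> j \<Longrightarrow> thesis"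
    have "\<mu> = \<nu>" if "\<kappa> = add_cell \<mu> i" "\<kappa> = add_cell \<nu> i" for i
      using that by (metis remove_add_cell)
    moreover have "\<kappa> = \<mu> \<or> (\<exists>i. \<kappa> = add_cell \<mu> i)" "\<kappa> = \<nu> \<or> (\<exists>i. \<kappa> = add_cell \<nu> i)"
      using grows by (auto simp: grows_def)
    ultimately show thesis using that by blast
  qed
  hence "is_shape \<rho> \<and> grows \<rho> \<mu> \<and> grows \<rho> \<nu> \<and> (x \<longrightarrow> \<mu> \<noteq> \<kappa> \<and> \<nu> \<noteq> \<kappa>) \<and>
    (\<rho> = \<mu> \<longleftrightarrow> \<nu> = \<kappa> \<or> x) \<and> (\<rho> = \<nu> \<longleftrightarrow> \<mu> = \<kappa> \<or> x) \<and> local_rule x \<rho> \<mu> \<nu> = \<kappa>"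
  proof cases
    case (4 i)
    show ?thesis
    proof (cases "\<mu> i = 0")
      case True
      hence "\<rho> = \<mu>" "x" using inv 4 by (auto simp: inverse_rule_def)
      thus ?thesis using 4 True Least_bump_new[of \<mu> i] shape
        by (auto simp: local_rule_def bump_def grows_def)
    next
      case False
      define g where "g = (GREATEST j. \<mu> i \<le> \<mu> j)"
      have g: "\<mu> g = \<mu> i" "i \<le> g" "\<mu> (Suc g) < \<mu> g"
        using Greatest_row[of \<mu> i] False shape by (auto simp: g_def)
      have \<rho>: "\<rho> = remove_cell \<mu> g" "\<not> x" using inv 4 False by (auto simp: inverse_rule_def g_def)
      have \<mu>: "\<mu> = add_cell \<rho> g" using \<rho> g False by (simp add: add_remove_cell)
      obtain e where "shape e \<mu>" using shape by (auto simp: is_shape_def)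
      hence "is_shape \<rho>" using g shape_remove_cell[of e \<mu> g] by (auto simp: \<rho> is_shape_def corners_def)
      \<comment> \<open>\<open>\<kappa>\<close> has its new cell in row \<open>i\<close>, the first
        of the rows of that length, while the removed cell was in row \<open>g\<close>, the last of
        them; only their common length enters \<open>bump\<close>.\<close>
      moreover have "bump \<mu> (\<mu> g) = \<kappa>"
        using Least_bump_new[of \<mu> i] shape 4 g by (simp add: bump_def)
      moreover have "changed_row \<rho> \<mu> = g" by (subst \<mu>) simp
      moreover have "\<rho> \<noteq> \<mu>" by (subst \<mu>) simp
      moreover have "grows \<rho> \<mu>" using \<mu> by (auto simp: grows_def)
      ultimately show ?thesis using 4 \<rho>(2) by (simp add: local_rule_def)
    qed
  next
    case (5 i j)
    have "\<mu> \<noteq> \<nu>" using 5 by auto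
    hence \<rho>: "\<rho> = (\<lambda>i. min (\<mu> i) (\<nu> i))" "\<not> x" using inv by (auto simp: inverse_rule_def)
    have p: "add_cell \<mu> i k = add_cell \<nu> j k" for k using 5 by simp
    have e: "\<mu> k = \<nu> k" if "k \<noteq> i" "k \<noteq> j" for k using p[of k] that by (simp add: add_cell_def)
    have "\<nu> i = Suc (\<mu> i)" "\<mu> j = Suc (\<nu> j)" using p[of i] p[of j] 5 by (auto simp: add_cell_def)
    hence "\<mu> k = add_cell \<rho> j k \<and> \<nu> k = add_cell \<rho> i k" for k
      using e[of k] \<open>i \<noteq> j\<close> by (cases "k = i"; cases "k = j") (simp_all add: \<rho> add_cell_def)
    hence 1: "\<mu> = add_cell \<rho> j" and 2: "\<nu> = add_cell \<rho> i" by (auto simp: fun_eq_iff)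
    have "is_shape \<rho>" unfolding \<rho> using is_shape_min[OF shape(1,2)] .
    moreover have "local_rule x \<rho> \<mu> \<nu> = \<kappa>"
    proof -
      have "\<kappa> = add_cell (add_cell \<rho> j) i" using 5(1) 1 by simp
      thus ?thesis using 1 2 \<open>\<mu> \<noteq> \<nu>\<close> \<rho>(2) \<open>i \<noteq> j\<close> by (simp add: local_rule_def add_cell_max)
    qed
    ultimately show ?thesis
      using \<rho>(2) grows_add_cell[OF 5(1)] grows_add_cell[OF 5(2)] grows_add_cell[OF 1] grows_add_cell[OF 2]
      by simp
  qed (use inv shape in \<open>auto simp: inverse_rule_def local_rule_def grows_def add_cell_max\<close>)
  thus "is_shape \<rho>" "grows \<rho> \<mu>" "grows \<rho> \<nu>" "x \<Longrightarrow> \<mu> \<noteq> \<kappa> \<and> \<nu> \<noteq> \<kappa>"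
    "\<rho> = \<mu> \<longleftrightarrow> \<nu> = \<kappa> \<or> x" "\<rho> = \<nu> \<longleftrightarrow> \<mu> = \<kappa> \<or> x"
    "local_rule x \<rho> \<mu> \<nu> = \<kappa>" by blast+
qed

text \<open>A cross fills the first empty row. Without a cross no new row is opened: when both sides
  at \<open>\<rho>\<close> add the same cell, the bump falls into a row of positive length.\<close>

lemma local_rule_pos:
  assumes shape: "is_shape \<rho>" "is_shape \<mu>" "is_shape \<nu>"
    and grows: "grows \<rho> \<mu>" "grows \<rho> \<nu>"
  shows "local_rule x \<rho> \<mu> \<nu> k > 0 \<longleftrightarrow> (if x then k = 0 \<or> \<rho> (k - 1) > 0 else \<mu> k > 0 \<or> \<nu> k > 0)"
proof (cases x)
  case True
  define e where "e = (LEAST i. \<rho> i \<le> 0)"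
  have e: "\<rho> e = 0" using Least_empty_row[OF shape(1)] by (simp add: e_def)
  have less: "\<rho> i > 0 \<longleftrightarrow> i < e" for i
    using not_less_Least[of i "\<lambda>i. \<rho> i \<le> 0"] is_shapeD[OF shape(1), of e i] e
    unfolding e_def[symmetric] by (cases "i < e") auto
  have "local_rule x \<rho> \<mu> \<nu> = add_cell \<rho> e" using True by (simp add: local_rule_def bump_def e_def)
  thus ?thesis using True by (auto simp: add_cell_def less)
next
  case False
  show ?thesis
  proof (cases "\<mu> = \<nu> \<and> \<mu> \<noteq> \<rho>")
    case True
    then obtain i where i: "\<mu> = add_cell \<rho> i" using grows by (auto simp: grows_def)
    have "\<mu> (LEAST j. \<mu> j \<le> \<mu> i) > 0"
      using Least_row[OF shape(2), of i] i by (simp add: add_cell_def)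
    moreover have "local_rule x \<rho> \<mu> \<nu> = add_cell \<mu> (LEAST j. \<mu> j \<le> \<mu> i)"
    proof -
      have "changed_row \<rho> \<mu> = i" using i by simp
      thus ?thesis using True False by (auto simp: local_rule_def bump_def)
    qed
    ultimately show ?thesis using False True by (auto simp: add_cell_def)
  qed (use False in \<open>auto simp: local_rule_def\<close>)
qed

section \<open>Growth diagrams of permutations\<close>

text \<open>\<open>growth X i j\<close> is the shape attached to the submatrix with row indices
  below \<open>i\<close> and column indices below \<open>j\<close>.\<close>

fun growth :: "(nat \<Rightarrow> nat \<Rightarrow> bool) \<Rightarrow> nat \<Rightarrow> nat \<Rightarrow> nat \<Rightarrow> nat" where
  "growth X 0 j = (\<lambda>_. 0)"
| "growth X (Suc i) 0 = (\<lambda>_. 0)"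
| "growth X (Suc i) (Suc j) = local_rule (X i j) (growth X i j) (growth X i (Suc j)) (growth X (Suc i) j)"

declare growth.simps(3) [simp del]

definition perm_matrices :: "nat \<Rightarrow> (nat \<Rightarrow> nat \<Rightarrow> bool) set" where
  "perm_matrices N = {X. (\<forall>i j. X i j \<longrightarrow> i < N \<and> j < N) \<and> (\<forall>i<N. \<exists>!j. X i j) \<and> (\<forall>j<N. \<exists>!i. X i j)}"

lemma perm_matrices_unique:
  assumes "X \<in> perm_matrices N"
  shows "X i j \<Longrightarrow> X i j' \<Longrightarrow> j = j'" and "X i j \<Longrightarrow> X i' j \<Longrightarrow> i = i'"
  using assms unfolding perm_matrices_def by blast+

lemma perm_matrices_less:
  assumes "X \<in> perm_matrices N"
  shows "X i j \<Longrightarrow> i < N \<and> j < N"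
  using assms unfolding perm_matrices_def by blast

lemma perm_matrices_ex:
  assumes "X \<in> perm_matrices N"
  shows "i < N \<Longrightarrow> \<exists>j<N. X i j" and "j < N \<Longrightarrow> \<exists>i<N. X i j"
  using assms unfolding perm_matrices_def by blast+

lemma growth_0_right [simp]: "growth X i 0 = (\<lambda>_. 0)"
  by (cases i) auto

lemma is_shape_0: "is_shape (\<lambda>_. 0)"
  by (simp add: is_shape_iff)

text \<open>The five facts depend on one another around each unit square, so they are proved
  together: \<open>P\<close> describes the side from column \<open>j\<close> to
  \<open>j + 1\<close>, \<open>Q\<close> the side from row \<open>i\<close> to
  \<open>i + 1\<close>.\<close>

lemma
  assumes X: "X \<in> perm_matrices N"
  shows is_shape_growth: "is_shape (growth X i j)"
    and grows_growth_row: "grows (growth X i j) (growth X (Suc i) j)"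
    and grows_growth_col: "grows (growth X i j) (growth X i (Suc j))"
    and growth_row_eq: "growth X i j = growth X (Suc i) j \<longleftrightarrow> \<not> (\<exists>j'<j. X i j')"
    and growth_col_eq: "growth X i j = growth X i (Suc j) \<longleftrightarrow> \<not> (\<exists>i'<i. X i' j)"
proof -
  let ?G = "growth X"
  note uniq = perm_matrices_unique[OF X]
  define P where "P i j \<longleftrightarrow> is_shape (?G i j) \<and> grows (?G i j) (?G i (Suc j)) \<and>
      (?G i j = ?G i (Suc j) \<longleftrightarrow> \<not> (\<exists>i'<i. X i' j))" for i j
  define Q where "Q i j \<longleftrightarrow> is_shape (?G (Suc i) j) \<and> grows (?G i j) (?G (Suc i) j) \<and>
      (?G i j = ?G (Suc i) j \<longleftrightarrow> \<not> (\<exists>j'<j. X i j'))" for i j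
  have step: "P (Suc i) j \<and> Q i (Suc j)" if P: "\<And>j. P i j" and Q: "Q i j" for i j
  proof -
    \<comment> \<open>A cross is alone in its row and column, so both sides at the near corner are
      trivial, as \<open>local_rule_forward\<close> requires.\<close>
    have x: "?G i (Suc j) = ?G i j \<and> ?G (Suc i) j = ?G i j" if "X i j"
    proof -
      have "\<not> (\<exists>i'<i. X i' j)" "\<not> (\<exists>j'<j. X i j')" using that uniq by blast+
      thus ?thesis using P[of j] Q unfolding P_def Q_def by simp
    qed
    have sh: "is_shape (?G i j)" "is_shape (?G i (Suc j))" "is_shape (?G (Suc i) j)"
      "grows (?G i j) (?G i (Suc j))" "grows (?G i j) (?G (Suc i) j)"
      using P[of j] P[of "Suc j"] Q by (auto simp: P_def Q_def)
    note L = local_rule_forward[OF sh x, folded growth.simps(3)]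
    have "(\<exists>i'<Suc i. X i' j) \<longleftrightarrow> (\<exists>i'<i. X i' j) \<or> X i j"
      "(\<exists>j'<Suc j. X i j') \<longleftrightarrow> (\<exists>j'<j. X i j') \<or> X i j" by (auto simp: less_Suc_eq)
    thus ?thesis using L sh P[of j] Q unfolding P_def Q_def by (auto simp: growth.simps(3))
  qed
  have Q: "Q i j" if P: "\<And>j. P i j" for i j
    by (induction j) (use step[OF P] in \<open>auto simp: Q_def is_shape_0 grows_def\<close>)
  have P: "P i j" for i j
  proof (induction i arbitrary: j)
    case 0
    show ?case by (auto simp: P_def is_shape_0 grows_def)
  next
    case (Suc i)
    show ?case using step[OF Suc Q[OF Suc]] by blast
  qed
  show "is_shape (?G i j)" "grows (?G i j) (?G i (Suc j))" "?G i j = ?G i (Suc j) \<longleftrightarrow> \<not> (\<exists>i'<i. X i' j)"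
    using P[of i j] by (auto simp: P_def)
  show "grows (?G i j) (?G (Suc i) j)" "?G i j = ?G (Suc i) j \<longleftrightarrow> \<not> (\<exists>j'<j. X i j')"
    using Q[OF P, of i j] by (auto simp: Q_def)
qed

lemma inverse_rule_growth:
  assumes "X \<in> perm_matrices N"
  shows "inverse_rule (growth X i (Suc j)) (growth X (Suc i) j) (growth X (Suc i) (Suc j)) = (growth X i j, X i j)"
proof -
  have "growth X i (Suc j) = growth X i j \<and> growth X (Suc i) j = growth X i j" if "X i j"
  proof -
    have "\<not> (\<exists>i'<i. X i' j)" "\<not> (\<exists>j'<j. X i j')"
      using that perm_matrices_unique[OF assms] by blast+
    thus ?thesis using growth_row_eq[OF assms, of i j] growth_col_eq[OF assms, of i j] by simp
  qed
  thus ?thesis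
    by (simp add: growth.simps(3) local_rule_forward is_shape_growth[OF assms] grows_growth_row[OF assms] grows_growth_col[OF assms])
qed

section \<open>Chains of shapes as boundaries of growth diagrams\<close>

definition shape_chains :: "nat \<Rightarrow> (nat \<Rightarrow> nat) \<Rightarrow> (nat \<Rightarrow> nat \<Rightarrow> nat) set" where
  "shape_chains n r = {c. c 0 = (\<lambda>_. 0) \<and> (\<forall>k. is_shape (c k)) \<and>
     (\<forall>k<n. \<exists>i. c (Suc k) = add_cell (c k) i) \<and> (\<forall>k\<ge>n. c k = r)}"

text \<open>A chain stays constant from \<open>n\<close> on, so it is a single total function from
  which its end can be read off. Deleting the last step must therefore also overwrite the
  tail.\<close>

lemma bij_betw_extend_chain:
  assumes "is_shape r"
  shows "bij_betw (\<lambda>(i, c) k. if k \<le> n then c k else r) (SIGMA i:corners r. shape_chains n (remove_cell r i)) (shape_chains (Suc n) r)"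
proof (rule bij_betwI')
  let ?f = "\<lambda>(i, c) k. if k \<le> n then c k else r"
  fix x y assume x: "x \<in> (SIGMA i:corners r. shape_chains n (remove_cell r i))"
    and y: "y \<in> (SIGMA i:corners r. shape_chains n (remove_cell r i))"
  obtain i c j e where xy: "x = (i, c)" "y = (j, e)" by fastforce
  have *: "i \<in> corners r" "j \<in> corners r" "\<And>k. k \<ge> n \<Longrightarrow> c k = remove_cell r i"
      "\<And>k. k \<ge> n \<Longrightarrow> e k = remove_cell r j" using x y xy by (auto simp: shape_chains_def)
  have pos: "r i > 0" "r j > 0" using * by (auto simp: corners_def)
  show "?f x = ?f y \<longleftrightarrow> x = y"
  proof
    assume eq: "?f x = ?f y"
    have ce: "c k = e k" if "k \<le> n" for k using fun_cong[OF eq, of k] xy that by simp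
    have "remove_cell r i = remove_cell r j" using ce[of n] * by simp
    hence "i = j" using pos by (auto simp: remove_cell_def fun_eq_iff split: if_splits)
    moreover have "c k = e k" for k using ce[of k] *(3,4)[of k] \<open>i = j\<close> by (cases "k \<le> n") auto
    ultimately show "x = y" using xy by auto
  qed auto
next
  let ?f = "\<lambda>(i, c) k. if k \<le> n then c k else r"
  fix x assume x: "x \<in> (SIGMA i:corners r. shape_chains n (remove_cell r i))"
  obtain i c where xc: "x = (i, c)" by fastforce
  have i: "i \<in> corners r" and c: "c \<in> shape_chains n (remove_cell r i)" using x xc by auto
  have "r i > 0" using i by (auto simp: corners_def)
  hence last: "\<exists>i. r = add_cell (c n) i" using c by (auto simp: shape_chains_def intro!: exI[of _ i] add_remove_cell[symmetric])
  define e where "e = ?f x"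
  have e: "e k = (if k \<le> n then c k else r)" for k by (simp add: e_def xc)
  have "e 0 = (\<lambda>_. 0)" "is_shape (e k)" for k using c assms by (auto simp: e shape_chains_def)
  moreover have "\<exists>i. e (Suc k) = add_cell (e k) i" if "k < Suc n" for k
  proof (cases "k = n")
    case True
    thus ?thesis using last by (simp add: e)
  next
    case False
    hence "k < n" using that by simp
    thus ?thesis using c by (simp add: e shape_chains_def)
  qed
  moreover have "e k = r" if "k \<ge> Suc n" for k using that by (simp add: e)
  ultimately have "e \<in> shape_chains (Suc n) r" unfolding shape_chains_def by blast
  thus "?f x \<in> shape_chains (Suc n) r" by (simp only: e_def)
next
  let ?f = "\<lambda>(i, c) k. if k \<le> n then c k else r"
  fix c assume c: "c \<in> shape_chains (Suc n) r"
  have "\<exists>i. c (Suc n) = add_cell (c n) i" using c unfolding shape_chains_def mem_Collect_eq by blast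
  moreover have "c (Suc n) = r" using c by (simp add: shape_chains_def)
  ultimately have "\<exists>i. r = add_cell (c n) i" by (simp only:)
  then obtain i where i: "r = add_cell (c n) i" ..
  have sh: "is_shape (c n)" using c by (auto simp: shape_chains_def)
  have "i \<in> corners r" using is_shapeD[OF sh, of i "Suc i"] by (auto simp: i corners_def add_cell_def)
  moreover have rem: "remove_cell r i = c n" by (simp add: i)
  have "(\<lambda>k. if k \<le> n then c k else c n) \<in> shape_chains n (remove_cell r i)"
    using c by (auto simp: shape_chains_def rem)
  moreover have "c = ?f (i, \<lambda>k. if k \<le> n then c k else c n)"
    using c by (auto simp: shape_chains_def fun_eq_iff)
  ultimately show "\<exists>x\<in>SIGMA i:corners r. shape_chains n (remove_cell r i). c = ?f x" by blast
qed

lemma card_shape_chains: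
  assumes "is_shape r"
  shows "finite (shape_chains n r) \<and> card (shape_chains n r) = num_chains n r"
  using assms
proof (induction n arbitrary: r)
  case 0
  have "shape_chains 0 r = (if r = (\<lambda>_. 0) then {\<lambda>_. r} else {})"
  proof -
    have "c = (\<lambda>_. r)" if "\<forall>k. c k = r" for c :: "nat \<Rightarrow> nat \<Rightarrow> nat" using that by blast
    thus ?thesis using is_shape_0 by (auto simp: shape_chains_def)
  qed
  thus ?case by simp
next
  case (Suc n)
  obtain d where d: "shape d r" using Suc.prems by (auto simp: is_shape_def)
  have IH: "finite (shape_chains n (remove_cell r i))" "card (shape_chains n (remove_cell r i)) = num_chains n (remove_cell r i)"
    if "i \<in> corners r" for i
    using Suc.IH[of "remove_cell r i"] shape_remove_cell[OF d that] by (auto simp: is_shape_def)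
  have fin: "finite (SIGMA i:corners r. shape_chains n (remove_cell r i))"
    using IH finite_corners[OF d] by auto
  note bij = bij_betw_extend_chain[OF Suc.prems, of n]
  show ?case
    using bij_betw_same_card[OF bij] bij_betw_finite[OF bij] fin IH finite_corners[OF d] by simp
qed

text \<open>With the existence of a boundary chain this yields the size of the final shape of a
  growth diagram without counting cells on the way.\<close>

lemma num_chains_size:
  "shape d r \<Longrightarrow> num_chains n r \<noteq> 0 \<Longrightarrow> sum r {..<d} = n"
proof (induction n arbitrary: r)
  case (Suc n)
  then obtain i where i: "i \<in> corners r" "num_chains n (remove_cell r i) \<noteq> 0"
    by (auto simp: sum_eq_0_iff[OF finite_corners[OF Suc.prems(1)]])
  thus ?case using Suc.IH[OF shape_remove_cell[OF Suc.prems(1) i(1)] i(2)] sum_remove_cell[OF Suc.prems(1) i(1)] by simp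
qed (auto split: if_splits)

text \<open>For a permutation matrix these two chains encode the pair of tableaux that the
  Robinson-Schensted correspondence, in its column insertion form, attaches to it.\<close>

definition boundary :: "nat \<Rightarrow> (nat \<Rightarrow> nat \<Rightarrow> bool) \<Rightarrow> (nat \<Rightarrow> nat \<Rightarrow> nat) \<times> (nat \<Rightarrow> nat \<Rightarrow> nat)" where
  "boundary N X = (\<lambda>k. growth X k N, \<lambda>k. growth X N k)"

lemma growth_stable:
  assumes "X \<in> perm_matrices N" "k \<ge> N"
  shows "growth X k N = growth X N N" "growth X N k = growth X N N"
proof -
  have no: "\<not> X i j" if "i \<ge> N \<or> j \<ge> N" for i j using that perm_matrices_less[OF assms(1), of i j] by auto
  show "growth X k N = growth X N N" using assms(2)
  proof (induction rule: dec_induct)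
    case (step m)
    thus ?case using growth_row_eq[OF assms(1), of m N] no by auto
  qed simp
  show "growth X N k = growth X N N" using assms(2)
  proof (induction rule: dec_induct)
    case (step m)
    thus ?case using growth_col_eq[OF assms(1), of N m] no by auto
  qed simp
qed

lemma boundary_in_shape_chains:
  assumes X: "X \<in> perm_matrices N"
  shows "boundary N X \<in> shape_chains N (growth X N N) \<times> shape_chains N (growth X N N)"
proof -
  have "\<exists>i. growth X (Suc k) N = add_cell (growth X k N) i" if "k < N" for k
    using grows_growth_row[OF X, of k N] growth_row_eq[OF X, of k N] perm_matrices_ex(1)[OF X that]
    unfolding grows_def by auto
  moreover have "\<exists>i. growth X N (Suc k) = add_cell (growth X N k) i" if "k < N" for k
    using grows_growth_col[OF X, of N k] growth_col_eq[OF X, of N k] perm_matrices_ex(2)[OF X that]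
    unfolding grows_def by auto
  ultimately show ?thesis
    by (simp add: boundary_def shape_chains_def is_shape_growth[OF X]) (blast intro: growth_stable[OF X])
qed

text \<open>\<open>inverse_rule\<close> recovers the near corner and the entry of a square from its
  other three corners, so the far sides determine everything inward.\<close>

lemma inj_on_boundary: "inj_on (boundary N) (perm_matrices N)"
proof (rule inj_onI)
  fix X Y assume X: "X \<in> perm_matrices N" and Y: "Y \<in> perm_matrices N" and eq: "boundary N X = boundary N Y"
  let ?P = "\<lambda>i j. growth X i j = growth Y i j"
  have b: "?P i N" "?P N j" for i j
    using eq by (simp_all add: boundary_def fun_eq_iff)
  have back_step: "?P i j \<and> X i j = Y i j" if "?P i (Suc j)" "?P (Suc i) j" "?P (Suc i) (Suc j)" for i j
  proof -
    have "(growth X i j, X i j) =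
        inverse_rule (growth X i (Suc j)) (growth X (Suc i) j) (growth X (Suc i) (Suc j))"
      by (rule inverse_rule_growth[OF X, symmetric])
    also have "\<dots> = inverse_rule (growth Y i (Suc j)) (growth Y (Suc i) j) (growth Y (Suc i) (Suc j))"
      by (simp only: that)
    also have "\<dots> = (growth Y i j, Y i j)" by (rule inverse_rule_growth[OF Y])
    finally show ?thesis by simp
  qed
  have row: "?P i j" if "\<forall>j\<le>N. ?P (Suc i) j" "j \<le> N" for i j
    using that(2)
  proof (induction rule: inc_induct)
    case (step n)
    show ?case by (rule conjunct1[OF back_step]) (use step.IH step.hyps that(1) in auto)
  qed (rule b)
  have P: "i \<le> N \<Longrightarrow> \<forall>j\<le>N. ?P i j" for i
    by (induction rule: inc_induct) (use b row in blast)+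
  have "X i j = Y i j" for i j
  proof (cases "i < N \<and> j < N")
    case True
    show ?thesis by (rule conjunct2[OF back_step]) (use True P[of i] P[of "Suc i"] in auto)
  next
    case False
    thus ?thesis using perm_matrices_less[OF X] perm_matrices_less[OF Y] by blast
  qed
  thus "X = Y" by blast
qed

text \<open>Here the indices are distances from the far corner of the diagram.\<close>

fun backward_growth :: "(nat \<Rightarrow> nat \<Rightarrow> nat) \<Rightarrow> (nat \<Rightarrow> nat \<Rightarrow> nat) \<Rightarrow> nat \<Rightarrow> nat \<Rightarrow> nat \<Rightarrow> nat" where
  "backward_growth b c 0 j = c j"
| "backward_growth b c (Suc i) 0 = b (Suc i)"
| "backward_growth b c (Suc i) (Suc j) =
     fst (inverse_rule (backward_growth b c (Suc i) j) (backward_growth b c i (Suc j)) (backward_growth b c i j))"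

text \<open>Meant for one row or column of squares: \<open>e j\<close> says that the
  \<open>j\<close>-th side crossing it is trivial. This can pass from true to false only at a cross,
  and each cross makes it do so; starting true and ending false, it does so exactly once.\<close>

lemma unique_change:
  fixes e :: "nat \<Rightarrow> bool"
  assumes "\<And>j. j < N \<Longrightarrow> e j \<longleftrightarrow> e (Suc j) \<or> x j" "\<And>j. j < N \<Longrightarrow> x j \<Longrightarrow> \<not> e (Suc j)" "e 0" "\<not> e N"
  shows "\<exists>!j. j < N \<and> x j"
proof -
  have anti: "i \<le> j \<Longrightarrow> j \<le> N \<Longrightarrow> e j \<Longrightarrow> e i" for i j
    by (induction j rule: dec_induct) (use assms(1) in auto)
  have "\<exists>j<N. x j"
  proof (rule ccontr)
    assume "\<not> ?thesis"
    hence "j \<le> N \<Longrightarrow> e j" for j by (induction j) (use assms(1,3) in auto)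
    thus False using assms(4) by simp
  qed
  moreover have False if "i < j" "i < N" "j < N" "x i" "x j" for i j
    using anti[of "Suc i" j] assms(1)[of j] assms(2)[of i] that by auto
  ultimately show ?thesis by (metis nat_neq_iff)
qed

text \<open>The square is filled backwards from the two chains. It remains to see that the near
  sides come out empty, that the crosses found form a permutation matrix, and that forward growth
  from them retraces the filling.\<close>

lemma boundary_surj:
  assumes b: "b \<in> shape_chains N r" and c: "c \<in> shape_chains N r"
  shows "\<exists>X\<in>perm_matrices N. boundary N X = (b, c)"
proof -
  define H where "H i j = backward_growth (\<lambda>k. b (N - k)) (\<lambda>k. c (N - k)) (N - i) (N - j)" for i j
  define X where "X i j \<longleftrightarrow> i < N \<and> j < N \<and> snd (inverse_rule (H i (Suc j)) (H (Suc i) j) (H (Suc i) (Suc j)))" for i j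
  have HN: "H N j = c j" if "j \<le> N" for j using that by (simp add: H_def)
  have HiN: "H i N = b i" if "i \<le> N" for i
  proof (cases "N - i")
    case 0
    hence "i = N" using that by simp
    thus ?thesis using b c by (simp add: H_def shape_chains_def)
  next
    case (Suc k)
    moreover have "N - Suc k = i" using Suc that by arith
    ultimately show ?thesis by (simp add: H_def)
  qed
  have rec: "inverse_rule (H i (Suc j)) (H (Suc i) j) (H (Suc i) (Suc j)) = (H i j, X i j)" if "i < N" "j < N" for i j
  proof -
    have "N - i = Suc (N - Suc i)" "N - j = Suc (N - Suc j)" using that by auto
    thus ?thesis using that by (simp add: H_def X_def prod_eq_iff)
  qed
  have bsh: "is_shape (b k)" "is_shape (c k)" for k using b c by (auto simp: shape_chains_def)
  have bgr: "grows (b k) (b (Suc k))" "grows (c k) (c (Suc k))" "b k \<noteq> b (Suc k)" "c k \<noteq> c (Suc k)" if "k < N" for k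
  proof -
    have "\<exists>i. b (Suc k) = add_cell (b k) i" "\<exists>i. c (Suc k) = add_cell (c k) i"
      using b c that by (simp_all add: shape_chains_def)
    thus "grows (b k) (b (Suc k))" "grows (c k) (c (Suc k))" "b k \<noteq> b (Suc k)" "c k \<noteq> c (Suc k)"
      using grows_add_cell by blast+
  qed
  define P where "P i j \<longleftrightarrow> is_shape (H i j) \<and> (j < N \<longrightarrow> grows (H i j) (H i (Suc j)))" for i j
  define Q where "Q i j \<longleftrightarrow> is_shape (H i j) \<and> grows (H i j) (H (Suc i) j)" for i j
  have back_step: "P i j \<and> Q i j" if P: "\<And>j. j \<le> N \<Longrightarrow> P (Suc i) j" and Q: "Q i (Suc j)" and ij: "i < N" "j < N" for i j
  proof -
    have "is_shape (H i (Suc j))" "is_shape (H (Suc i) j)" "is_shape (H (Suc i) (Suc j))"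
      "grows (H i (Suc j)) (H (Suc i) (Suc j))" "grows (H (Suc i) j) (H (Suc i) (Suc j))"
      using P[of j] P[of "Suc j"] Q ij by (auto simp: P_def Q_def)
    note L = local_rule_backward[OF this rec[OF ij]]
    show ?thesis unfolding P_def Q_def using L by blast
  qed
  have Q: "\<And>j. j \<le> N \<Longrightarrow> Q i j" if P: "\<And>j. j \<le> N \<Longrightarrow> P (Suc i) j" and i: "i < N" for i
  proof -
    fix j assume "j \<le> N"
    thus "Q i j"
    proof (induction rule: inc_induct)
      case base
      show ?case using i by (simp add: Q_def HiN bsh bgr)
    next
      case (step n)
      thus ?case using back_step[OF P, of n] i by blast
    qed
  qed
  have P: "i \<le> N \<Longrightarrow> \<forall>j\<le>N. P i j" for i
  proof (induction rule: inc_induct)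
    case base
    show ?case by (auto simp: P_def HN bsh bgr)
  next
    case (step m)
    have Pm: "\<And>j. j \<le> N \<Longrightarrow> P (Suc m) j" using step by blast
    have "P m j" if "j \<le> N" for j
    proof (cases "j = N")
      case True
      thus ?thesis using Q[OF Pm, of N] step by (simp add: P_def Q_def)
    next
      case False
      thus ?thesis using back_step[OF Pm, of j] Q[OF Pm, of "Suc j"] that step by auto
    qed
    thus ?case by blast
  qed
  have Q': "Q i j" if "i < N" "j \<le> N" for i j using Q[of i j] P[of "Suc i"] that by auto
  have L: "local_rule (X i j) (H i j) (H i (Suc j)) (H (Suc i) j) = H (Suc i) (Suc j) \<and>
     (X i j \<longrightarrow> H i (Suc j) \<noteq> H (Suc i) (Suc j) \<and> H (Suc i) j \<noteq> H (Suc i) (Suc j)) \<and>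
     (H i j = H i (Suc j) \<longleftrightarrow> H (Suc i) j = H (Suc i) (Suc j) \<or> X i j) \<and>
     (H i j = H (Suc i) j \<longleftrightarrow> H i (Suc j) = H (Suc i) (Suc j) \<or> X i j)" if ij: "i < N" "j < N" for i j
  proof -
    have "is_shape (H i (Suc j))" "is_shape (H (Suc i) j)" "is_shape (H (Suc i) (Suc j))"
      "grows (H i (Suc j)) (H (Suc i) (Suc j))" "grows (H (Suc i) j) (H (Suc i) (Suc j))"
      using Q'[of i "Suc j"] P[of "Suc i"] ij by (auto simp: P_def Q_def)
    note L = local_rule_backward[OF this rec[OF ij]]
    show ?thesis using L by blast
  qed
  have grows_0: "r = (\<lambda>_. 0)" if "grows r (\<lambda>_. 0)" for r
    using that by (auto simp: grows_def add_cell_def fun_eq_iff split: if_splits)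
  have b0: "b 0 = (\<lambda>_. 0)" "c 0 = (\<lambda>_. 0)" using b c by (auto simp: shape_chains_def)
  \<comment> \<open>A shape that grows into the empty one is empty, so emptiness spreads along the
    near side from the corner where \<open>b\<close> starts.\<close>
  have H0: "H 0 j = (\<lambda>_. 0)" if "j \<le> N" for j
    using that
  proof (induction rule: inc_induct)
    case (step n)
    have "P 0 n" using P[of 0] step.hyps by simp
    thus ?case using step.IH step.hyps grows_0[of "H 0 n"] by (simp add: P_def)
  qed (simp add: HiN b0)
  have Hi0: "H i 0 = (\<lambda>_. 0)" if "i \<le> N" for i
    using that
  proof (induction rule: inc_induct)
    case (step n)
    have "Q n 0" using Q' step.hyps by simp
    thus ?case using step.IH grows_0[of "H n 0"] by (simp add: Q_def)
  qed (simp add: HN b0)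
  have X: "X \<in> perm_matrices N"
  proof -
    have "\<exists>!j. j < N \<and> X i j" if "i < N" for i
    proof (rule unique_change[where e = "\<lambda>j. H i j = H (Suc i) j"])
      show "\<not> H i N = H (Suc i) N" using bgr[of i] that by (simp add: HiN)
    qed (use L that Hi0 in auto)
    moreover have "\<exists>!i. i < N \<and> X i j" if "j < N" for j
    proof (rule unique_change[where e = "\<lambda>i. H i j = H i (Suc j)"])
      show "\<not> H N j = H N (Suc j)" using bgr[of j] that by (simp add: HN)
    qed (use L that H0 in auto)
    moreover have "i < N \<and> X i j \<longleftrightarrow> X i j" "j < N \<and> X i j \<longleftrightarrow> X i j" for i j by (auto simp: X_def)
    ultimately have "\<forall>i<N. \<exists>!j. X i j" "\<forall>j<N. \<exists>!i. X i j" by simp_all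
    moreover have "\<forall>i j. X i j \<longrightarrow> i < N \<and> j < N" by (simp add: X_def)
    ultimately show ?thesis unfolding perm_matrices_def by blast
  qed
  have GH: "growth X i j = H i j" if "i \<le> N" "j \<le> N" for i j
    using that
  proof (induction i arbitrary: j)
    case (Suc i)
    note row = Suc.IH and i = Suc.prems(1)
    show ?case using Suc.prems(2)
    proof (induction j)
      case (Suc j)
      thus ?case using row[of j] row[of "Suc j"] i L[of i j] by (simp add: growth.simps(3))
    qed (use i in \<open>simp add: Hi0\<close>)
  qed (simp add: H0)
  have "growth X k N = b k \<and> growth X N k = c k" for k
  proof (cases "k \<le> N")
    case True
    thus ?thesis by (simp add: GH HiN HN)
  next
    case False
    hence "b k = b N" "c k = c N" "b N = c N" using b c by (auto simp: shape_chains_def)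
    thus ?thesis using False growth_stable[OF X, of k] by (simp add: GH HiN HN)
  qed
  hence "boundary N X = (b, c)" by (simp add: boundary_def fun_eq_iff)
  thus ?thesis using X by blast
qed

text \<open>The Robinson-Schensted bijection restricted to final shapes with at most
  \<open>d\<close> rows. A chain determines its end, so the pairs for different shapes are disjoint
  and their numbers add up.\<close>

lemma card_perm_matrices_growth:
  "card {X \<in> perm_matrices N. growth X N N d = 0} = (\<Sum>r\<in>box_shapes d N N. (num_chains N r)\<^sup>2)"
proof -
  have sh: "is_shape r" if "r \<in> box_shapes d N N" for r
    using that by (auto simp: box_shapes_def is_shape_def)
  have disj: "r = r'" if "b \<in> shape_chains N r" "b \<in> shape_chains N r'" for b r r'
    using that by (auto simp: shape_chains_def)
  have ne: "growth X N N \<in> box_shapes d N N" if X: "X \<in> perm_matrices N" "growth X N N d = 0" for X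
  proof -
    let ?r = "growth X N N"
    have s: "is_shape ?r" by (rule is_shape_growth[OF X(1)])
    hence shape: "shape d ?r" using X(2) by (intro shapeI) (auto simp: is_shape_iff)
    have "shape_chains N ?r \<noteq> {}" using boundary_in_shape_chains[OF X(1)] by auto
    hence "num_chains N ?r \<noteq> 0" using card_shape_chains[OF s, of N] by (metis card_0_eq)
    hence sum: "sum ?r {..<d} = N" by (rule num_chains_size[OF shape])
    have "?r 0 \<le> N"
    proof (cases "d = 0")
      case False
      hence "?r 0 \<le> sum ?r {..<d}" by (intro member_le_sum) auto
      thus ?thesis using sum by simp
    qed (use X(2) in auto)
    thus ?thesis using shape sum by (simp add: box_shapes_def)
  qed
  have "bij_betw (boundary N) {X \<in> perm_matrices N. growth X N N d = 0}
     (\<Union>r\<in>box_shapes d N N. shape_chains N r \<times> shape_chains N r)"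
    unfolding bij_betw_def
  proof (intro conjI equalityI subsetI)
    show "inj_on (boundary N) {X \<in> perm_matrices N. growth X N N d = 0}"
      by (rule inj_on_subset[OF inj_on_boundary]) auto
  next
    fix x assume "x \<in> boundary N ` {X \<in> perm_matrices N. growth X N N d = 0}"
    thus "x \<in> (\<Union>r\<in>box_shapes d N N. shape_chains N r \<times> shape_chains N r)"
      using boundary_in_shape_chains ne by blast
  next
    fix x assume "x \<in> (\<Union>r\<in>box_shapes d N N. shape_chains N r \<times> shape_chains N r)"
    then obtain r b c where r: "r \<in> box_shapes d N N" "b \<in> shape_chains N r" "c \<in> shape_chains N r" "x = (b, c)" by auto
    then obtain X where X: "X \<in> perm_matrices N" "boundary N X = (b, c)" using boundary_surj by blast
    have "growth X N N = r" using X r by (auto simp: boundary_def shape_chains_def dest: fun_cong[of _ _ N])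
    hence "growth X N N d = 0" using r by (auto simp: box_shapes_def shape_def)
    thus "x \<in> boundary N ` {X \<in> perm_matrices N. growth X N N d = 0}" using X r by force
  qed
  hence "card {X \<in> perm_matrices N. growth X N N d = 0} =
     card (\<Union>r\<in>box_shapes d N N. shape_chains N r \<times> shape_chains N r)" by (rule bij_betw_same_card)
  also have "\<dots> = (\<Sum>r\<in>box_shapes d N N. card (shape_chains N r \<times> shape_chains N r))"
    by (rule card_UN_disjoint) (auto simp: finite_box_shapes card_shape_chains sh dest: disj)
  also have "\<dots> = (\<Sum>r\<in>box_shapes d N N. (num_chains N r)\<^sup>2)"
    by (rule sum.cong) (auto simp: card_shape_chains sh power2_eq_square card_cartesian_product)
  finally show ?thesis .
qed

section \<open>Increasing sequences of crosses and the number of rows\<close>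

definition has_increasing :: "(nat \<Rightarrow> nat) \<Rightarrow> nat \<Rightarrow> nat \<Rightarrow> nat \<Rightarrow> bool" where
  "has_increasing f i j m \<longleftrightarrow> (\<exists>I\<subseteq>{..<i}. card I = m \<and> f ` I \<subseteq> {..<j} \<and> strict_mono_on I f)"

lemma has_increasing_0 [simp]: "has_increasing f i j 0"
  unfolding has_increasing_def by (intro exI[of _ "{}"]) (auto simp: strict_mono_on_def)

lemma has_increasing_empty [simp]:
  "\<not> has_increasing f 0 j (Suc m)" "\<not> has_increasing f i 0 (Suc m)"
  by (auto simp: has_increasing_def)

text \<open>The point \<open>(i, j)\<close> extends any increasing sequence in the smaller
  rectangle; conversely, dropping the last position lowers both bounds by one, whether or not that
  position was \<open>i\<close>.\<close>

lemma has_increasing_hit: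
  assumes "f i = j"
  shows "has_increasing f (Suc i) (Suc j) (Suc m) \<longleftrightarrow> has_increasing f i j m"
proof
  assume "has_increasing f (Suc i) (Suc j) (Suc m)"
  then obtain I where I: "I \<subseteq> {..<Suc i}" "card I = Suc m" "f ` I \<subseteq> {..<Suc j}" "strict_mono_on I f"
    by (auto simp: has_increasing_def)
  have fin: "finite I" using I(2) by (simp add: card_ge_0_finite)
  have ne: "I \<noteq> {}" using I(2) by auto
  define x where "x = Max I"
  have x: "x \<in> I" using fin ne by (simp add: x_def)
  have "y < x \<and> f y < f x" if "y \<in> I - {x}" for y
  proof -
    have "y < x" using Max_ge[OF fin, of y] that by (auto simp: x_def)
    thus ?thesis using I(4) x that by (auto simp: strict_mono_on_def)
  qed
  moreover have "x < Suc i" "f x < Suc j" using I(1,3) x by auto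
  ultimately have "I - {x} \<subseteq> {..<i}" "f ` (I - {x}) \<subseteq> {..<j}" by fastforce+
  moreover have "card (I - {x}) = m" using x I(2) by simp
  moreover have "strict_mono_on (I - {x}) f" using I(4) by (auto simp: strict_mono_on_def)
  ultimately show "has_increasing f i j m" unfolding has_increasing_def by blast
next
  assume "has_increasing f i j m"
  then obtain I where I: "I \<subseteq> {..<i}" "card I = m" "f ` I \<subseteq> {..<j}" "strict_mono_on I f"
    by (auto simp: has_increasing_def)
  have "finite I" "i \<notin> I" using I(1) finite_subset by auto
  hence "card (insert i I) = Suc m" using I(2) by simp
  moreover have "insert i I \<subseteq> {..<Suc i}" "f ` insert i I \<subseteq> {..<Suc j}" using I(1,3) assms by (auto simp: less_Suc_eq)
  moreover have "strict_mono_on (insert i I) f"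
    using I(1,3,4) assms by (auto simp: strict_mono_on_def dest: less_asym)
  ultimately show "has_increasing f (Suc i) (Suc j) (Suc m)" unfolding has_increasing_def by blast
qed

lemma has_increasing_mono:
  assumes "has_increasing f i j m" "i \<le> i'" "j \<le> j'"
  shows "has_increasing f i' j' m"
proof -
  obtain I where "I \<subseteq> {..<i}" "card I = m" "f ` I \<subseteq> {..<j}" "strict_mono_on I f"
    using assms(1) by (auto simp: has_increasing_def)
  moreover have "{..<i} \<subseteq> {..<i'}" "{..<j} \<subseteq> {..<j'}" using assms by auto
  ultimately show ?thesis unfolding has_increasing_def by (intro exI[of _ I]) auto
qed

text \<open>If the sequence uses position \<open>i\<close>, its value there is below
  \<open>j\<close> and is the largest, so the bound on the values can be lowered; otherwise the
  bound on the positions can.\<close>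

lemma has_increasing_miss:
  assumes "f i \<noteq> j"
  shows "has_increasing f (Suc i) (Suc j) m \<longleftrightarrow> has_increasing f i (Suc j) m \<or> has_increasing f (Suc i) j m"
proof
  assume "has_increasing f (Suc i) (Suc j) m"
  then obtain I where I: "I \<subseteq> {..<Suc i}" "card I = m" "f ` I \<subseteq> {..<Suc j}" "strict_mono_on I f"
    by (auto simp: has_increasing_def)
  show "has_increasing f i (Suc j) m \<or> has_increasing f (Suc i) j m"
  proof (cases "i \<in> I")
    case True
    hence fi: "f i < j" using I(3) assms by (auto simp: less_Suc_eq)
    have "f y < j" if "y \<in> I" for y
    proof (cases "y = i")
      case False
      hence "y < i" using that I(1) by (auto simp: less_Suc_eq)
      hence "f y < f i" using I(4) True that by (auto simp: strict_mono_on_def)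
      thus ?thesis using fi by simp
    qed (use fi in simp)
    thus ?thesis using I unfolding has_increasing_def by blast
  next
    case False
    hence "I \<subseteq> {..<i}" using I(1) by (force simp: less_Suc_eq)
    thus ?thesis using I unfolding has_increasing_def by blast
  qed
next
  assume "has_increasing f i (Suc j) m \<or> has_increasing f (Suc i) j m"
  thus "has_increasing f (Suc i) (Suc j) m" by (auto elim: has_increasing_mono)
qed

text \<open>Both sides obey the same recursion: the two branches of \<open>local_rule_pos\<close>
  correspond to \<open>has_increasing_hit\<close> and \<open>has_increasing_miss\<close>.\<close>

lemma growth_pos_iff:
  assumes X: "X \<in> perm_matrices N" and f: "\<And>i j. i < N \<Longrightarrow> X i j \<longleftrightarrow> f i = j"
  shows "i \<le> N \<Longrightarrow> growth X i j k > 0 \<longleftrightarrow> has_increasing f i j (Suc k)"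
proof (induction i arbitrary: j k)
  case (Suc i)
  note row = Suc.IH and i = Suc.prems
  show ?case
  proof (induction j arbitrary: k)
    case (Suc j)
    have pos: "growth X (Suc i) (Suc j) k > 0 \<longleftrightarrow>
        (if X i j then k = 0 \<or> growth X i j (k - 1) > 0 else growth X i (Suc j) k > 0 \<or> growth X (Suc i) j k > 0)"
      unfolding growth.simps(3)
      by (rule local_rule_pos) (rule is_shape_growth[OF X] grows_growth_row[OF X] grows_growth_col[OF X])+
    show ?case
    proof (cases "f i = j")
      case True
      hence "X i j" using f i by simp
      thus ?thesis unfolding pos using row[of j "k - 1"] i has_increasing_hit[of f i j k] True
        by (cases k) simp_all
    next
      case False
      hence "\<not> X i j" using f i by simp
      thus ?thesis using row[of "Suc j" k] Suc.IH i has_increasing_miss[of f i j, OF False] by (simp add: pos)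
    qed
  qed simp
qed simp

section \<open>Permutations as permutation matrices\<close>

text \<open>Reversing the columns turns decreasing subsequences into increasing ones.\<close>

definition perm_matrix :: "nat \<Rightarrow> (nat \<Rightarrow> nat) \<Rightarrow> nat \<Rightarrow> nat \<Rightarrow> bool" where
  "perm_matrix N \<pi> i j \<longleftrightarrow> i < N \<and> N - \<pi> (Suc i) = j"

text \<open>Positions and values start at 1, matrix indices at 0. Since the values lie between 1 and
  \<open>N\<close>, the column \<open>N - \<pi> (Suc i)\<close> is below \<open>N\<close> and
  determines the value.\<close>

lemma bij_betw_perm_matrix:
  "bij_betw (perm_matrix N) {\<pi>. \<pi> permutes {1..N}} (perm_matrices N)"
proof (rule bij_betwI')
  fix \<pi> \<sigma> assume "\<pi> \<in> {\<pi>. \<pi> permutes {1..N}}" "\<sigma> \<in> {\<pi>. \<pi> permutes {1..N}}"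
  hence p: "\<pi> permutes {1..N}" "\<sigma> permutes {1..N}" by auto
  show "perm_matrix N \<pi> = perm_matrix N \<sigma> \<longleftrightarrow> \<pi> = \<sigma>"
  proof
    assume eq: "perm_matrix N \<pi> = perm_matrix N \<sigma>"
    show "\<pi> = \<sigma>"
    proof
      fix k show "\<pi> k = \<sigma> k"
      proof (cases "k \<in> {1..N}")
        case True
        then obtain i where i: "k = Suc i" "i < N" by (cases k) auto
        have "perm_matrix N \<pi> i (N - \<pi> k)" using i by (simp add: perm_matrix_def)
        hence "N - \<pi> k = N - \<sigma> k" using i by (simp add: eq) (simp add: perm_matrix_def)
        moreover have "\<pi> k \<in> {1..N}" "\<sigma> k \<in> {1..N}" using permutes_in_image[OF p(1), of k] permutes_in_image[OF p(2), of k] True by simp_all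
        ultimately show ?thesis by auto
      next
        case False
        thus ?thesis using p by (simp add: permutes_not_in)
      qed
    qed
  qed simp
next
  fix \<pi> assume "\<pi> \<in> {\<pi>. \<pi> permutes {1..N}}"
  hence p: "\<pi> permutes {1..N}" by auto
  have im: "\<pi> (Suc i) \<in> {1..N}" if "i < N" for i using that by (subst permutes_in_image[OF p]) auto
  have "\<exists>!i. perm_matrix N \<pi> i j" if j: "j < N" for j
  proof (rule ex1I)
    define k where "k = inv_into UNIV \<pi> (N - j)"
    have "k \<in> {1..N}" unfolding k_def using j by (subst permutes_in_image[OF permutes_inv[OF p]]) auto
    then obtain i where i: "k = Suc i" "i < N" by (cases k) auto
    have k: "\<pi> (Suc i) = N - j" using permutes_inverses(1)[OF p] by (simp add: i(1)[symmetric] k_def)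
    thus "perm_matrix N \<pi> (k - 1) j" using i j by (simp add: perm_matrix_def)
    fix a assume "perm_matrix N \<pi> a j"
    hence "a < N" "\<pi> (Suc a) = N - j" using im[of a] by (auto simp: perm_matrix_def)
    hence "\<pi> (Suc a) = \<pi> k" using k i by simp
    hence "Suc a = k" using permutes_inj[OF p] by (simp add: inj_eq)
    thus "a = k - 1" by simp
  qed
  moreover have "N - \<pi> (Suc i) < N" if "i < N" for i using im[OF that] by auto
  ultimately show "perm_matrix N \<pi> \<in> perm_matrices N"
    unfolding perm_matrices_def by (auto simp: perm_matrix_def)
next
  fix X assume X: "X \<in> perm_matrices N"
  define g where "g i = (THE j. X i j)" for i
  have g: "X i (g i)" if "i < N" for i
  proof -
    have "\<exists>!j. X i j" using X that by (simp add: perm_matrices_def)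
    from theI'[OF this] show ?thesis by (simp add: g_def)
  qed
  have gN: "g i < N" if "i < N" for i using g[OF that] perm_matrices_less[OF X] by blast
  define \<pi> where "\<pi> k = (if k \<in> {1..N} then N - g (k - 1) else k)" for k
  have "inj_on \<pi> {1..N}"
  proof (rule inj_onI)
    fix k m assume km: "k \<in> {1..N}" "m \<in> {1..N}" "\<pi> k = \<pi> m"
    hence lt: "k - 1 < N" "m - 1 < N" by auto
    have "N - g (k - 1) = N - g (m - 1)" using km by (simp add: \<pi>_def)
    hence "g (k - 1) = g (m - 1)" using gN[OF lt(1)] gN[OF lt(2)] by linarith
    hence "k - 1 = m - 1" using g[of "k - 1"] g[of "m - 1"] lt perm_matrices_unique(2)[OF X, of "k - 1" "g (k - 1)" "m - 1"] by simp
    thus "k = m" using km by auto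
  qed
  moreover have "\<pi> ` {1..N} \<subseteq> {1..N}"
  proof safe
    fix k assume k: "k \<in> {1..N}"
    hence "g (k - 1) < N" by (intro gN) auto
    thus "\<pi> k \<in> {1..N}" using k by (auto simp: \<pi>_def)
  qed
  ultimately have "bij_betw \<pi> {1..N} {1..N}" by (simp add: bij_betw_def endo_inj_surj)
  hence p: "\<pi> permutes {1..N}" by (rule bij_imp_permutes) (auto simp: \<pi>_def)
  have "X = perm_matrix N \<pi>"
  proof (intro ext)
    fix i j
    have "X i j \<longleftrightarrow> g i = j" if "i < N" using g[OF that] perm_matrices_unique(1)[OF X] by blast
    moreover have "N - \<pi> (Suc i) = g i" if "i < N" using gN[OF that] that by (simp add: \<pi>_def)
    ultimately show "X i j = perm_matrix N \<pi> i j" using perm_matrices_less[OF X, of i j]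
      by (auto simp: perm_matrix_def)
  qed
  thus "\<exists>\<pi>\<in>{\<pi>. \<pi> permutes {1..N}}. X = perm_matrix N \<pi>" using p by blast
qed

lemma has_decreasing_subseq_iff:
  assumes p: "\<pi> permutes {1..N}"
  shows "has_decreasing_subseq m N \<pi> \<longleftrightarrow> has_increasing (\<lambda>i. N - \<pi> (Suc i)) N N m"
proof
  assume "has_decreasing_subseq m N \<pi>"
  then obtain I where I: "I \<subseteq> {1..N}" "card I = m" "strict_antimono_on I \<pi>"
    by (auto simp: has_decreasing_subseq_def)
  define J where "J = (\<lambda>k. k - 1) ` I"
  have IJ: "I = Suc ` J" using I(1) by (force simp: J_def image_image image_iff)
  have im: "\<pi> k \<in> {1..N}" if "k \<in> I" for k using that I(1) permutes_in_image[OF p, of k] by blast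
  have "J \<subseteq> {..<N}" using I(1) by (auto simp: IJ)
  moreover have "card J = m" using I(2) by (simp add: IJ card_image)
  moreover have "(\<lambda>i. N - \<pi> (Suc i)) ` J \<subseteq> {..<N}" using im by (fastforce simp: IJ)
  moreover have "strict_mono_on J (\<lambda>i. N - \<pi> (Suc i))"
  proof (rule strict_mono_onI)
    fix a b assume ab: "a \<in> J" "b \<in> J" "a < b"
    hence "\<pi> (Suc b) < \<pi> (Suc a)" using I(3) by (auto simp: IJ monotone_on_def)
    thus "N - \<pi> (Suc a) < N - \<pi> (Suc b)" using im[of "Suc a"] ab by (auto simp: IJ)
  qed
  ultimately show "has_increasing (\<lambda>i. N - \<pi> (Suc i)) N N m" unfolding has_increasing_def by blast
next
  assume "has_increasing (\<lambda>i. N - \<pi> (Suc i)) N N m"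
  then obtain J where J: "J \<subseteq> {..<N}" "card J = m" "strict_mono_on J (\<lambda>i. N - \<pi> (Suc i))"
    by (auto simp: has_increasing_def)
  have "Suc ` J \<subseteq> {1..N}" using J(1) by auto
  moreover have "card (Suc ` J) = m" using J(2) by (simp add: card_image)
  moreover have "strict_antimono_on (Suc ` J) \<pi>"
  proof (rule monotone_onI)
    fix a b assume ab: "a \<in> Suc ` J" "b \<in> Suc ` J" "a < b"
    then obtain i j where ij: "a = Suc i" "b = Suc j" "i \<in> J" "j \<in> J" "i < j" by auto
    hence "N - \<pi> a < N - \<pi> b" using J(3) by (auto simp: strict_mono_on_def)
    thus "\<pi> b < \<pi> a" by linarith
  qed
  ultimately show "has_decreasing_subseq m N \<pi>" unfolding has_decreasing_subseq_def by blast
qed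

lemma num_perms_no_decreasing_eq:
  "num_perms_no_decreasing d N = (\<Sum>r\<in>box_shapes d N N. (num_chains N r)\<^sup>2)"
proof -
  have iff: "\<not> has_decreasing_subseq (d + 1) N \<pi> \<longleftrightarrow> growth (perm_matrix N \<pi>) N N d = 0" if p: "\<pi> permutes {1..N}" for \<pi>
  proof -
    have "perm_matrix N \<pi> \<in> perm_matrices N" using bij_betwE[OF bij_betw_perm_matrix] p by blast
    hence "growth (perm_matrix N \<pi>) N N d > 0 \<longleftrightarrow> has_increasing (\<lambda>i. N - \<pi> (Suc i)) N N (Suc d)"
      by (rule growth_pos_iff) (auto simp: perm_matrix_def)
    thus ?thesis using has_decreasing_subseq_iff[OF p, of "d + 1"] by auto
  qed
  have "bij_betw (perm_matrix N) {\<pi>. \<pi> permutes {1..N} \<and> \<not> has_decreasing_subseq (d + 1) N \<pi>}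
     {X \<in> perm_matrices N. growth X N N d = 0}"
  proof -
    have surj: "perm_matrices N = perm_matrix N ` {\<pi>. \<pi> permutes {1..N}}"
      using bij_betw_perm_matrix[of N] by (simp add: bij_betw_def)
    have "inj_on (perm_matrix N) {\<pi>. \<pi> permutes {1..N}}"
      using bij_betw_perm_matrix[of N] by (simp add: bij_betw_def)
    hence inj: "inj_on (perm_matrix N) {\<pi>. \<pi> permutes {1..N} \<and> \<not> has_decreasing_subseq (d + 1) N \<pi>}"
      by (rule inj_on_subset) blast
    have "{X \<in> perm_matrix N ` A. Q X} = perm_matrix N ` {\<pi> \<in> A. Q (perm_matrix N \<pi>)}" for A Q by blast
    hence "{X \<in> perm_matrices N. growth X N N d = 0} =
        perm_matrix N ` {\<pi>. \<pi> permutes {1..N} \<and> growth (perm_matrix N \<pi>) N N d = 0}"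
      unfolding surj by simp
    moreover have "{\<pi>. \<pi> permutes {1..N} \<and> growth (perm_matrix N \<pi>) N N d = 0} =
        {\<pi>. \<pi> permutes {1..N} \<and> \<not> has_decreasing_subseq (d + 1) N \<pi>}"
      by (intro Collect_cong conj_cong refl iff[symmetric])
    ultimately show ?thesis using inj by (simp only: bij_betw_def)
  qed
  hence "card {\<pi>. \<pi> permutes {1..N} \<and> \<not> has_decreasing_subseq (d + 1) N \<pi>} =
     card {X \<in> perm_matrices N. growth X N N d = 0}" by (rule bij_betw_same_card)
  thus ?thesis by (simp add: num_perms_no_decreasing_def card_perm_matrices_growth)
qed

section \<open>Ratios of factorials\<close>

text \<open>The factors \<open>k\<close> and \<open>M + 1 - k\<close> of the ratio are paired; their product is at most \<open>c\<^sup>2\<close>, and close to it.\<close>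

lemma fact_ratio_bounds:
  fixes M l :: nat
  assumes l: "l \<le> M" "M \<le> 2 * l"
  defines "t \<equiv> 2 * l - M" and "c \<equiv> real (M + 1) / 2"
  shows "fact l / fact (M - l) \<le> c ^ t"
    and "(1 - real t ^ 3 / real (M + 1) ^ 2) * c ^ t \<le> fact l / fact (M - l)"
proof -
  define y where "y = (fact l / fact (M - l) / c ^ t :: real)"
  have c: "c > 0" by (simp add: c_def)
  have tM: "t \<le> M" using l by (simp add: t_def)
  let ?I = "{Suc (M - l)..l}"
  have card: "card ?I = t" using l by (simp add: t_def)
  have ratio: "fact l / fact (M - l) = (\<Prod>k\<in>?I. real k)"
  proof -
    have "fact l = fact (M - l) * (\<Prod>k\<in>?I. k)" using l by (intro fact_eq_fact_times) auto
    hence "real (fact l) = real (fact (M - l) * (\<Prod>k\<in>?I. k))" by (simp only:)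
    thus ?thesis by simp
  qed
  have rev: "(\<Prod>k\<in>?I. real k) = (\<Prod>k\<in>?I. real (M + 1 - k))"
    by (rule prod.reindex_bij_witness[of _ "\<lambda>k. M + 1 - k" "\<lambda>k. M + 1 - k"]) (use l in auto)
  have sq: "(fact l / fact (M - l)) ^ 2 = (\<Prod>k\<in>?I. real k * real (M + 1 - k))"
    unfolding power2_eq_square prod.distrib ratio using rev by simp
  have y2: "y ^ 2 = (\<Prod>k\<in>?I. real k * real (M + 1 - k) / c ^ 2)"
    unfolding prod_dividef prod_constant card sq[symmetric] y_def power_divide[of _ "c ^ t"] by (simp add: power_commutes mult.commute flip: power_mult)
  have factor: "1 - real t ^ 2 / real (M + 1) ^ 2 \<le> real k * real (M + 1 - k) / c ^ 2 \<and> real k * real (M + 1 - k) / c ^ 2 \<le> 1"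
    if k: "k \<in> ?I" for k
  proof -
    \<comment> \<open>Completing the square: the two factors have mean \<open>c\<close>.\<close>
    have eq: "real k * real (M + 1 - k) / c ^ 2 = 1 - (2 * real k - real (M + 1)) ^ 2 / real (M + 1) ^ 2"
    proof -
      define P where "P = real (M + 1)"
      have P: "P > 0" and e: "real (M + 1 - k) = P - real k" using k l by (auto simp: P_def of_nat_diff)
      show ?thesis unfolding e c_def P_def[symmetric] using P by (simp add: field_simps power2_eq_square)
    qed
    have "\<bar>2 * real k - real (M + 1)\<bar> \<le> real t" using k l by (auto simp: t_def of_nat_diff)
    hence "(2 * real k - real (M + 1)) ^ 2 \<le> real t ^ 2" by (rule abs_le_square_iff[THEN iffD1, OF order.trans]) simp
    thus ?thesis unfolding eq by (simp add: divide_right_mono)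
  qed
  have t1: "real t ^ 2 / real (M + 1) ^ 2 \<le> 1" using tM by (simp add: power_mono)
  have up: "y ^ 2 \<le> 1"
    unfolding y2 by (rule prod_le_1) (use factor in auto)
  have "1 - real t ^ 3 / real (M + 1) ^ 2 = 1 + real t * (- (real t ^ 2 / real (M + 1) ^ 2))"
    by (simp add: power3_eq_cube power2_eq_square)
  also have "\<dots> \<le> (1 + - (real t ^ 2 / real (M + 1) ^ 2)) ^ t"
    using t1 by (intro Bernoulli_inequality) simp
  also have "\<dots> = (\<Prod>k\<in>?I. 1 - real t ^ 2 / real (M + 1) ^ 2)" by (simp only: prod_constant card diff_conv_add_uminus)
  also have "\<dots> \<le> y ^ 2"
    unfolding y2 by (rule prod_mono) (use t1 factor in auto)
  finally have low: "1 - real t ^ 3 / real (M + 1) ^ 2 \<le> y ^ 2" .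
  have y0: "0 \<le> y" using c by (simp add: y_def)
  have y1: "y \<le> 1" using up y0 by (simp add: power_le_one_iff abs_square_le_1)
  \<comment> \<open>Pairing only controls \<open>y ^ 2\<close>; because \<open>y \<le> 1\<close>,
    its lower bound passes to \<open>y\<close> without a square root.\<close>
  have "y ^ 2 \<le> y" using y0 y1 by (simp add: power2_eq_square mult_left_le)
  moreover have "fact l / fact (M - l) = y * c ^ t" using c by (simp add: y_def)
  ultimately show "fact l / fact (M - l) \<le> c ^ t"
    "(1 - real t ^ 3 / real (M + 1) ^ 2) * c ^ t \<le> fact l / fact (M - l)"
    using low y1 c by (auto intro!: mult_right_mono mult_left_le_one_le simp: y0)
qed

text \<open>The real exponent covers both sides of \<open>M / 2\<close>. Below the middle,
  exchanging \<open>l\<close> and \<open>M - l\<close> inverts the ratio and the power of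
  \<open>c\<close>, so the lower bound turns into an upper bound with
  \<open>inverse (1 - \<delta>)\<close>.\<close>

lemma fact_ratio_powr_bounds:
  fixes M l :: nat and \<tau> :: real
  assumes l: "l \<le> M" and \<tau>: "\<bar>2 * real l - real M\<bar> \<le> \<tau>"
  defines "\<delta> \<equiv> \<tau> ^ 3 / real (M + 1) ^ 2" and "c \<equiv> real (M + 1) / 2"
  assumes \<delta>: "\<delta> < 1"
  shows "(1 - \<delta>) * c powr (2 * real l - real M) \<le> fact l / fact (M - l)"
    and "fact l / fact (M - l) \<le> inverse (1 - \<delta>) * c powr (2 * real l - real M)"
proof -
  have c: "c > 0" by (simp add: c_def)
  have \<tau>0: "0 \<le> \<tau>" using \<tau> by linarith
  have \<delta>0: "0 \<le> \<delta>" using \<tau>0 by (simp add: \<delta>_def)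
  have inv1: "1 \<le> inverse (1 - \<delta>)" using \<delta> \<delta>0 by (simp add: one_le_inverse)
  have *: "(1 - \<delta>) * c powr (2 * real l - real M) \<le> fact l / fact (M - l) \<and>
           fact l / fact (M - l) \<le> c powr (2 * real l - real M)"
    if "l \<le> M" "M \<le> 2 * l" "\<bar>2 * real l - real M\<bar> \<le> \<tau>" for l
  proof -
    have t: "c ^ (2 * l - M) = c powr (2 * real l - real M)"
      using c that by (simp add: powr_realpow[symmetric] of_nat_diff)
    have "real (2 * l - M) ^ 3 \<le> \<tau> ^ 3" using that by (intro power_mono) (auto simp: of_nat_diff)
    hence "1 - \<delta> \<le> 1 - real (2 * l - M) ^ 3 / real (M + 1) ^ 2"
      by (simp add: \<delta>_def divide_right_mono)
    hence "(1 - \<delta>) * c ^ (2 * l - M) \<le> (1 - real (2 * l - M) ^ 3 / real (M + 1) ^ 2) * c ^ (2 * l - M)"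
      using c by (intro mult_right_mono) auto
    also have "\<dots> \<le> fact l / fact (M - l)" using fact_ratio_bounds(2)[OF that(1,2)] by (simp add: c_def)
    finally show ?thesis using fact_ratio_bounds(1)[OF that(1,2), folded c_def] by (simp add: t)
  qed
  have "(1 - \<delta>) * c powr (2 * real l - real M) \<le> fact l / fact (M - l) \<and>
        fact l / fact (M - l) \<le> inverse (1 - \<delta>) * c powr (2 * real l - real M)"
  proof (cases "M \<le> 2 * l")
    case True
    have "c powr (2 * real l - real M) \<le> inverse (1 - \<delta>) * c powr (2 * real l - real M)"
      using inv1 by (intro mult_le_cancel_right1[THEN iffD2]) auto
    thus ?thesis using *[OF l True \<tau>] by auto
  next
    case False
    define m where "m = M - l"
    define a where "a = c powr (2 * real l - real M)"
    define y where "y = (fact l / fact (M - l) :: real)"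
    have a: "a > 0" and y: "y > 0" using c by (auto simp: a_def y_def)
    have m: "m \<le> M" "M \<le> 2 * m" "2 * real m - real M = - (2 * real l - real M)" "M - m = l"
      using False l by (auto simp: m_def of_nat_diff)
    have "(1 - \<delta>) * inverse a \<le> inverse y \<and> inverse y \<le> inverse a"
    proof -
      have "c powr (2 * real m - real M) = inverse a" by (simp only: m(3) powr_minus a_def)
      moreover have "fact m / fact (M - m) = inverse y" by (simp add: y_def m_def l)
      moreover have "\<bar>2 * real m - real M\<bar> \<le> \<tau>" using \<tau> by (simp only: m(3) abs_minus_cancel)
      ultimately show ?thesis using *[OF m(1,2)] by simp
    qed
    hence "a \<le> y" "(1 - \<delta>) * y \<le> a"
      using a y by (simp_all add: field_simps)
    moreover have "(1 - \<delta>) * a \<le> a" using \<delta>0 a by (simp add: algebra_simps)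
    moreover have "y \<le> inverse (1 - \<delta>) * a" using \<open>(1 - \<delta>) * y \<le> a\<close> \<delta> by (simp add: field_simps)
    ultimately show ?thesis unfolding a_def y_def by linarith
  qed
  thus "(1 - \<delta>) * c powr (2 * real l - real M) \<le> fact l / fact (M - l)"
    "fact l / fact (M - l) \<le> inverse (1 - \<delta>) * c powr (2 * real l - real M)" by auto
qed

lemma prod_powr_balanced:
  assumes "finite A" "(\<Sum>i\<in>A. e i) = (0 :: real)" "c > (0 :: real)"
  shows "(\<Prod>i\<in>A. c powr e i) = 1"
  using assms by (simp add: powr_sum[symmetric])

lemma prod_fact_ratio_bounds:
  fixes M :: nat and l :: "nat \<Rightarrow> nat" and \<tau> :: real
  assumes l: "\<And>i. i < d \<Longrightarrow> l i \<le> M" and \<tau>: "\<And>i. i < d \<Longrightarrow> \<bar>2 * real (l i) - real M\<bar> \<le> \<tau>"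
    and bal: "(\<Sum>i<d. 2 * real (l i) - real M) = 0"
  defines "\<delta> \<equiv> \<tau> ^ 3 / real (M + 1) ^ 2"
  assumes \<delta>: "\<delta> < 1"
  shows "(1 - \<delta>) ^ d \<le> (\<Prod>i<d. fact (l i) / fact (M - l i))"
    and "(\<Prod>i<d. fact (l i) / fact (M - l i)) \<le> inverse (1 - \<delta>) ^ d"
proof -
  define c where "c = real (M + 1) / 2"
  have c: "c > 0" by (simp add: c_def)
  have one: "(\<Prod>i<d. c powr (2 * real (l i) - real M)) = 1"
    by (rule prod_powr_balanced) (use bal c in auto)
  note b = fact_ratio_powr_bounds[OF l \<tau> \<delta>[unfolded \<delta>_def], folded \<delta>_def c_def]
  have "(1 - \<delta>) ^ d = (\<Prod>i<d. (1 - \<delta>) * c powr (2 * real (l i) - real M))"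
    by (simp add: prod.distrib one)
  also have "\<dots> \<le> (\<Prod>i<d. fact (l i) / fact (M - l i))"
    using b(1) \<delta> by (intro prod_mono) auto
  finally show "(1 - \<delta>) ^ d \<le> (\<Prod>i<d. fact (l i) / fact (M - l i))" .
  have "(\<Prod>i<d. fact (l i) / fact (M - l i)) \<le> (\<Prod>i<d. inverse (1 - \<delta>) * c powr (2 * real (l i) - real M))"
    using b(2) by (intro prod_mono) auto
  also have "\<dots> = inverse (1 - \<delta>) ^ d"
    by (simp add: prod.distrib one)
  finally show "(\<Prod>i<d. fact (l i) / fact (M - l i)) \<le> inverse (1 - \<delta>) ^ d" .
qed

section \<open>Decay away from the centre\<close>

text \<open>Quotient of the weights that the Poisson distribution with parameter \<open>n\<close> gives to \<open>l\<close> and to \<open>n\<close>.\<close>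

definition pois :: "nat \<Rightarrow> nat \<Rightarrow> real" where
  "pois n l = fact n * real n powr (real l - real n) / fact l"

lemma pois_pos: "n > 0 \<Longrightarrow> pois n l > 0"
  by (simp add: pois_def)

lemma pois_Suc: "n > 0 \<Longrightarrow> pois n (Suc l) = pois n l * (real n / real (Suc l))"
  by (simp add: pois_def powr_diff powr_add field_simps)

lemma pois_self: "n > 0 \<Longrightarrow> pois n n = 1"
  by (simp add: pois_def)

lemma pois_above:
  assumes n: "n > 0"
  shows "k \<le> n \<Longrightarrow> pois n (n + k) \<le> exp (- (real k ^ 2 / (4 * real n)))"
proof (induction k)
  case 0
  thus ?case by (simp add: pois_self n)
next
  case (Suc k)
  define x where "x = real (Suc k) / real n"
  have x: "0 \<le> x" "x \<le> 1" using Suc.prems n by (auto simp: x_def)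
  \<comment> \<open>One step contributes the factor \<open>1 / (1 + x)\<close>. The restriction
    \<open>k \<le> n\<close> ensures \<open>x \<le> 1\<close>, where this factor is at most
    \<open>exp (- (x / 2))\<close>.\<close>
  have "exp (x / 2) \<le> 1 + x" using exp_bound_lemma[of "x / 2"] x by simp
  hence "real n / real (Suc (n + k)) \<le> exp (- (x / 2))"
    using n by (simp add: x_def exp_minus field_simps)
  hence "pois n (n + k) * (real n / real (Suc (n + k))) \<le> exp (- (real k ^ 2 / (4 * real n))) * exp (- (x / 2))"
    using Suc by (intro mult_mono) auto
  hence "pois n (n + Suc k) \<le> exp (- (real k ^ 2 / (4 * real n))) * exp (- (x / 2))"
    by (simp only: add_Suc_right pois_Suc[OF n])
  also have "\<dots> = exp (- ((real k ^ 2 + 2 * real (Suc k)) / (4 * real n)))"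
    using n by (simp add: exp_add[symmetric] x_def field_simps)
  also have "\<dots> \<le> exp (- (real (Suc k) ^ 2 / (4 * real n)))"
    using n by (simp add: divide_right_mono power2_eq_square algebra_simps)
  finally show ?case .
qed

lemma pois_antimono:
  assumes n: "n > 0" and l: "n \<le> l"
  shows "l \<le> m \<Longrightarrow> pois n m \<le> pois n l"
proof (induction m rule: dec_induct)
  case (step m)
  have "pois n m * (real n / real (Suc m)) \<le> pois n m * 1"
    using pois_pos[OF n] step l by (intro mult_left_mono) (auto simp: less_imp_le)
  thus ?case using step by (simp add: pois_Suc n)
qed simp

text \<open>Stepping from \<open>n - k\<close> down to \<open>n - k - 1\<close> multiplies the
  weight by \<open>1 - k / n \<le> exp (- (k / n))\<close>; the exponents form an arithmetic
  series.\<close>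

lemma pois_below:
  assumes n: "n > 0"
  shows "k \<le> n \<Longrightarrow> pois n (n - k) \<le> exp (- (real k * (real k - 1) / (2 * real n)))"
proof (induction k)
  case 0
  thus ?case by (simp add: pois_self n)
next
  case (Suc k)
  have "pois n (n - k) = pois n (n - Suc k) * (real n / real (n - k))"
    using pois_Suc[OF n, of "n - Suc k"] Suc.prems by (simp add: Suc_diff_Suc)
  hence "pois n (n - Suc k) = pois n (n - k) * (1 - real k / real n)"
    using Suc.prems n by (simp add: field_simps of_nat_diff)
  also have "\<dots> \<le> exp (- (real k * (real k - 1) / (2 * real n))) * exp (- (real k / real n))"
  proof (intro mult_mono)
    show "1 - real k / real n \<le> exp (- (real k / real n))" using exp_ge_add_one_self[of "- (real k / real n)"] by simp
  qed (use Suc in \<open>auto simp: field_simps\<close>)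
  also have "\<dots> = exp (- (real (Suc k) * (real (Suc k) - 1) / (2 * real n)))"
    using n by (simp add: exp_add[symmetric] field_simps)
  finally show ?case .
qed

lemma pois_le_1: "n > 0 \<Longrightarrow> pois n l \<le> 1"
proof (cases "n \<le> l")
  case True
  assume "n > 0"
  thus ?thesis using pois_antimono[of n n l] True by (simp add: pois_self)
next
  case False
  assume n: "n > 0"
  have "real (n - l) * (real (n - l) - 1) \<ge> 0" using False by (intro mult_nonneg_nonneg) auto
  thus ?thesis using pois_below[OF n, of "n - l"] False n
    by (simp add: order.trans[OF _ exp_le_one_iff[THEN iffD2]])
qed

lemma pois_tail:
  assumes n: "n > 0" and \<kappa>: "2 \<le> \<kappa>" "\<kappa> \<le> real n" and l: "\<kappa> \<le> \<bar>real l - real n\<bar>"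
  shows "pois n l \<le> exp (- (\<kappa> ^ 2 / (4 * real n)))"
proof (cases "n \<le> l")
  case True
  \<comment> \<open>\<open>pois_above\<close> reaches only up to \<open>2 n\<close>; beyond,
    monotonicity leads back to \<open>2 n\<close>, whose deviation \<open>n\<close> is still at
    least \<open>\<kappa>\<close>.\<close>
  define k where "k = min (l - n) n"
  have k: "\<kappa> \<le> real k" using \<kappa> l True by (auto simp: k_def min_def of_nat_diff)
  have "pois n l \<le> pois n (n + k)" using True by (intro pois_antimono n) (auto simp: k_def)
  also have "\<dots> \<le> exp (- (real k ^ 2 / (4 * real n)))" by (rule pois_above) (auto simp: n k_def)
  also have "\<dots> \<le> exp (- (\<kappa> ^ 2 / (4 * real n)))"
    using k \<kappa> n by (simp add: divide_right_mono power_mono)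
  finally show ?thesis .
next
  case False
  define k where "k = n - l"
  have k: "\<kappa> \<le> real k" "k \<le> n" "n - k = l" using \<kappa> l False by (auto simp: k_def of_nat_diff)
  have "pois n l \<le> exp (- (real k * (real k - 1) / (2 * real n)))" using pois_below[OF n k(2)] k by simp
  also have "\<dots> \<le> exp (- (\<kappa> ^ 2 / (4 * real n)))"
  proof -
    have "\<kappa> ^ 2 \<le> real k ^ 2" using k \<kappa> by (intro power_mono) auto
    \<comment> \<open>The hypothesis \<open>2 \<le> \<kappa>\<close> gives \<open>k \<ge> 2\<close>,
      so the bound from \<open>pois_below\<close> takes the same form as the one from above.\<close>
    also have "\<dots> \<le> 2 * (real k * (real k - 1))"
    proof -
      have "0 \<le> real k * (real k - 2)" using k \<kappa> by (intro mult_nonneg_nonneg) auto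
      thus ?thesis by (simp add: power2_eq_square algebra_simps)
    qed
    finally have "\<kappa> ^ 2 / (4 * real n) \<le> 2 * (real k * (real k - 1)) / (4 * real n)"
      by (rule divide_right_mono) simp
    thus ?thesis using n by simp
  qed
  finally show ?thesis .
qed

text \<open>The shifted lengths of the rectangle are \<open>n + i\<close>, and a lower bound free of
  \<open>n\<close> is wanted. It holds stepwise, since
  \<open>n / (n + i + 1) \<ge> 1 / (i + 2)\<close> for \<open>n \<ge> 1\<close>.\<close>

lemma pois_shift_ge:
  assumes n: "n > 0"
  shows "1 / fact (Suc i) \<le> pois n (n + i)"
proof (induction i)
  case 0
  thus ?case by (simp add: pois_self n)
next
  case (Suc i)
  have "1 / fact (Suc (Suc i)) = 1 / fact (Suc i) * (1 / real (Suc (Suc i)))" by (simp add: field_simps)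
  also have "\<dots> \<le> pois n (n + i) * (real n / real (Suc (n + i)))"
  proof (intro mult_mono Suc)
    have "real i + 1 \<le> real n * (real i + 1)" using n by simp
    thus "1 / real (Suc (Suc i)) \<le> real n / real (Suc (n + i))"
      using n by (simp add: field_simps)
  qed (use pois_pos[OF n] in \<open>auto simp: less_imp_le\<close>)
  finally show ?case by (simp add: pois_Suc n)
qed

section \<open>The dimension of a shape and of its complement\<close>

lemma card_box_shapes: "card (box_shapes d q k) \<le> (q + 1) ^ d"
proof -
  have "inj_on (\<lambda>r. restrict r {..<d}) (box_shapes d q k)"
  proof (rule inj_onI)
    fix r s assume rs: "r \<in> box_shapes d q k" "s \<in> box_shapes d q k" "restrict r {..<d} = restrict s {..<d}"
    show "r = s"
    proof
      fix i show "r i = s i"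
        using fun_cong[OF rs(3), of i] rs(1,2)
        by (cases "i < d") (auto simp: box_shapes_def shape_ge not_less)
    qed
  qed
  moreover have "(\<lambda>r. restrict r {..<d}) ` box_shapes d q k \<subseteq> {..<d} \<rightarrow>\<^sub>E {..q}"
    using box_shapes_le by fastforce
  ultimately have "card (box_shapes d q k) \<le> card ({..<d} \<rightarrow>\<^sub>E {..q})"
    by (intro card_inj_on_le) (auto intro: finite_PiE)
  thus ?thesis by (simp add: card_PiE)
qed

lemma beta_compl_shape:
  assumes "r \<in> box_shapes d q k" "i < d"
  shows "beta d r i \<le> q + d - 1" "beta d (compl_shape d q r) i = (q + d - 1) - beta d r (d - 1 - i)"
  using assms box_shapes_le[OF assms(1), of "d - 1 - i"] box_shapes_le[OF assms(1), of i]
  by (auto simp: beta_def compl_shape_def)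

lemma sum_beta:
  "(\<Sum>i<d. beta d r i) = sum r {..<d} + (\<Sum>i<d. i)"
proof -
  have "(\<Sum>i<d. r (d - 1 - i)) = sum r {..<d}"
    by (rule sum.reindex_bij_witness[of _ "\<lambda>j. d - 1 - j" "\<lambda>j. d - 1 - j"]) auto
  thus ?thesis by (simp add: beta_def sum.distrib)
qed

definition ffdet_shape :: "nat \<Rightarrow> (nat \<Rightarrow> nat) \<Rightarrow> real" where
  "ffdet_shape d r = of_int (ffdet d (\<lambda>i. int (beta d r i)))"

text \<open>By \<open>num_chains_formula\<close> the determinant is a count times a positive
  factor.\<close>

lemma ffdet_shape_nonneg:
  assumes "shape d r"
  shows "0 \<le> ffdet_shape d r"
proof -
  have "0 \<le> fact (sum r {..<d}) * ffdet_shape d r"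
    using num_chains_formula[OF assms refl, symmetric]
    by (simp add: ffdet_shape_def prod_nonneg)
  thus ?thesis
    using mult_le_cancel_left_pos[of "fact (sum r {..<d}) :: real" 0 "ffdet_shape d r"] by simp
qed

text \<open>Complementation reverses the order of the shifted lengths and reflects each at
  \<open>(q + d - 1) / 2\<close>. Both operations preserve the determinant up to sign, and
  nonnegativity fixes the sign.\<close>

lemma ffdet_shape_compl:
  assumes r: "r \<in> box_shapes d q k"
  shows "ffdet_shape d (compl_shape d q r) = ffdet_shape d r"
proof -
  define \<sigma> where "\<sigma> i = (if i < d then d - 1 - i else i)" for i
  have "bij_betw \<sigma> {0..<d} {0..<d}"
    by (rule bij_betw_byWitness[of _ \<sigma>]) (auto simp: \<sigma>_def)
  hence \<sigma>: "\<sigma> permutes {0..<d}" by (rule bij_imp_permutes) (auto simp: \<sigma>_def)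
  have "ffdet d (\<lambda>i. int (beta d (compl_shape d q r) i)) = ffdet d (\<lambda>i. int (q + d - 1) - int (beta d r (\<sigma> i)))"
  proof (rule ffdet_cong)
    fix i assume i: "i < d"
    hence "beta d r (d - 1 - i) \<le> q + d - 1" by (intro beta_compl_shape(1)[OF r]) simp
    thus "int (beta d (compl_shape d q r) i) = int (q + d - 1) - int (beta d r (\<sigma> i))"
      using i by (simp only: beta_compl_shape(2)[OF r] \<sigma>_def if_True of_nat_diff)
  qed
  also have "\<bar>\<dots>\<bar> = \<bar>ffdet d (\<lambda>i. int (beta d r i))\<bar>"
    using ffdet_permute[OF \<sigma>, of "\<lambda>i. int (beta d r i)"] ffdet_reflect[of d "int (q + d - 1)"] by simp
  finally have "\<bar>ffdet_shape d (compl_shape d q r)\<bar> = \<bar>ffdet_shape d r\<bar>"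
    unfolding ffdet_shape_def by (metis of_int_abs)
  thus ?thesis
    using r compl_shape_in_box[OF r] by (simp add: ffdet_shape_nonneg box_shapes_def)
qed

text \<open>With \<open>k\<close> half the area, shape and complement have equally many cells;
  \<open>fact k\<close> and the determinants cancel, and only the factorials of the shifted lengths
  remain.\<close>

lemma num_chains_compl:
  assumes r: "r \<in> box_shapes d q k" and k: "d * q = 2 * k"
  shows "real (num_chains k (compl_shape d q r)) =
    real (num_chains k r) * (\<Prod>i<d. fact (beta d r i) / fact (q + d - 1 - beta d r i))"
proof -
  let ?C = "compl_shape d q r"
  have sh: "shape d r" "sum r {..<d} = k" "shape d ?C" "sum ?C {..<d} = k"
    using r compl_shape_in_box[OF r] k by (auto simp: box_shapes_def)
  have "(\<Prod>i<d. fact (beta d ?C i)) = (\<Prod>i<d. fact (q + d - 1 - beta d r (d - 1 - i)) :: real)"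
    using beta_compl_shape[OF r] by simp
  also have "\<dots> = (\<Prod>i<d. fact (q + d - 1 - beta d r i))"
    by (rule prod.reindex_bij_witness[of _ "\<lambda>j. d - 1 - j" "\<lambda>j. d - 1 - j"]) auto
  finally have P: "(\<Prod>i<d. fact (beta d ?C i)) = (\<Prod>i<d. fact (q + d - 1 - beta d r i) :: real)" .
  have "real (num_chains k ?C) * (\<Prod>i<d. fact (q + d - 1 - beta d r i)) =
        real (num_chains k r) * (\<Prod>i<d. fact (beta d r i))"
    using num_chains_formula[OF sh(1,2)] num_chains_formula[OF sh(3,4)] ffdet_shape_compl[OF r]
    by (simp add: P ffdet_shape_def)
  thus ?thesis by (simp add: prod_dividef field_simps)
qed

lemma num_chains_central:
  fixes \<kappa> \<delta> :: real
  assumes r: "r \<in> box_shapes d (2 * n) (d * n)" and d: "d > 0"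
    and central: "\<And>i. i < d \<Longrightarrow> \<bar>real (r i) - real n\<bar> \<le> \<kappa>"
  defines "\<delta> \<equiv> (2 * \<kappa> + real d) ^ 3 / real (2 * n + d) ^ 2"
  assumes \<delta>: "\<delta> < 1"
  shows "(1 - \<delta>) ^ d * num_chains (d * n) r \<le> num_chains (d * n) (compl_shape d (2 * n) r)"
    and "num_chains (d * n) (compl_shape d (2 * n) r) \<le> inverse (1 - \<delta>) ^ d * num_chains (d * n) r"
proof -
  define M where "M = 2 * n + d - 1"
  define P where "P = (\<Prod>i<d. fact (beta d r i) / fact (M - beta d r i) :: real)"
  have M1: "M + 1 = 2 * n + d" using d by (simp add: M_def)
  have le: "beta d r i \<le> M" if "i < d" for i
    using beta_compl_shape(1)[OF r that] by (simp add: M_def)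
  \<comment> \<open>The deviation splits into twice that of the row from \<open>n\<close> and a
    staircase term of absolute value at most \<open>d\<close>.\<close>
  have close: "\<bar>2 * real (beta d r i) - real M\<bar> \<le> 2 * \<kappa> + real d" if "i < d" for i
  proof -
    have "2 * real (beta d r i) - real M = 2 * (real (r (d - 1 - i)) - real n) + (2 * real i - (real d - 1))"
      using d by (simp add: beta_def M_def of_nat_diff)
    moreover have "\<bar>2 * real i - (real d - 1)\<bar> \<le> real d" using that by (simp add: abs_if)
    moreover have "\<bar>real (r (d - 1 - i)) - real n\<bar> \<le> \<kappa>" using that by (intro central) simp
    moreover have "\<bar>x\<bar> \<le> 2 * \<kappa> + e" if "x = 2 * a + b" "\<bar>b\<bar> \<le> e" "\<bar>a\<bar> \<le> \<kappa>" for x a b e :: real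
      using that by linarith
    ultimately show ?thesis by blast
  qed
  \<comment> \<open>The shifted lengths sum to \<open>d n + d (d - 1) / 2\<close>, exactly half of
    \<open>d M\<close>.\<close>
  have bal: "(\<Sum>i<d. 2 * real (beta d r i) - real M) = 0"
  proof -
    have "2 * (\<Sum>i<d. i) = d * (d - 1)"
      using gauss_sum_nat[of "d - 1"] d by (cases d) (auto simp: lessThan_Suc_atMost atMost_atLeast0)
    hence "2 * (\<Sum>i<d. beta d r i) = d * M"
      using r d by (simp add: sum_beta box_shapes_def M_def algebra_simps add_mult_distrib2 diff_mult_distrib2)
    hence "real (2 * (\<Sum>i<d. beta d r i)) = real (d * M)" by (simp only:)
    thus ?thesis by (simp add: sum_subtractf sum_distrib_left)
  qed
  have P: "(1 - \<delta>) ^ d \<le> P" "P \<le> inverse (1 - \<delta>) ^ d"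
    using prod_fact_ratio_bounds[of d "beta d r" M "2 * \<kappa> + real d", OF le close bal] \<delta>
    unfolding P_def \<delta>_def M1 by auto
  have eq: "real (num_chains (d * n) (compl_shape d (2 * n) r)) = P * real (num_chains (d * n) r)"
    using num_chains_compl[OF r] by (simp add: P_def M_def)
  show "(1 - \<delta>) ^ d * num_chains (d * n) r \<le> num_chains (d * n) (compl_shape d (2 * n) r)"
    "num_chains (d * n) (compl_shape d (2 * n) r) \<le> inverse (1 - \<delta>) ^ d * num_chains (d * n) r"
    unfolding eq using P by (auto intro: mult_right_mono)
qed

text \<open>Replacing reciprocal factorials by Poisson ratios costs a prefactor common to all shapes
  with \<open>d n\<close> cells, which disappears when two dimensions are compared.\<close>

lemma num_chains_pois:
  assumes sh: "shape d r" "sum r {..<d} = d * n" and n: "n > 0"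
  shows "real (num_chains (d * n) r) =
     fact (d * n) / (fact n ^ d * real n powr real (\<Sum>i<d. i)) * (ffdet_shape d r * (\<Prod>i<d. pois n (beta d r i)))"
proof -
  have "(\<Sum>i<d. real (beta d r i) - real n) = real (\<Sum>i<d. beta d r i) - real d * real n"
    by (simp add: sum_subtractf)
  also have "\<dots> = real (\<Sum>i<d. i)" using sh by (simp add: sum_beta)
  finally have e: "(\<Prod>i<d. real n powr (real (beta d r i) - real n)) = real n powr real (\<Sum>i<d. i)"
    using n by (simp add: powr_sum[symmetric])
  have pois: "(\<Prod>i<d. pois n (beta d r i)) = fact n ^ d * real n powr real (\<Sum>i<d. i) / (\<Prod>i<d. fact (beta d r i))"
    by (simp add: pois_def prod_dividef prod.distrib e del: of_nat_sum)
  have "(\<Prod>i<d. fact (beta d r i) :: real) > 0" by (simp add: prod_pos)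
  moreover have "real (num_chains (d * n) r) * (\<Prod>i<d. fact (beta d r i)) = fact (d * n) * ffdet_shape d r"
    using num_chains_formula[OF sh] by (simp add: ffdet_shape_def)
  ultimately have "real (num_chains (d * n) r) = fact (d * n) * ffdet_shape d r / (\<Prod>i<d. fact (beta d r i))"
    by (simp only: eq_divide_eq) simp
  moreover have "real n powr real (\<Sum>i<d. i) > 0" using n by simp
  ultimately show ?thesis unfolding pois by simp
qed

text \<open>The shifted lengths of the rectangle are a translate of those of the empty shape, and a
  translation is a composition of two reflections. A positive integer is at least 1.\<close>

lemma ffdet_shape_rect_ge: "1 \<le> ffdet_shape d (rect_shape d n)"
proof -
  have "\<bar>ffdet d (\<lambda>i. int n - (0 - int i))\<bar> = \<bar>ffdet d int\<bar>"
    by (simp only: ffdet_reflect)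
  also have "\<dots> = (\<Prod>i<d. fact i)" by (simp add: ffdet_id prod_nonneg)
  also have "ffdet d (\<lambda>i. int n - (0 - int i)) = ffdet d (\<lambda>i. int (beta d (rect_shape d n) i))"
    by (rule ffdet_cong) (auto simp: beta_def rect_shape_def)
  finally have "\<bar>ffdet d (\<lambda>i. int (beta d (rect_shape d n) i))\<bar> > 0" by (simp add: prod_pos)
  moreover have "ffdet d (\<lambda>i. int (beta d (rect_shape d n) i)) \<ge> 0"
    using ffdet_shape_nonneg[OF shape_rect_shape, of d n] by (simp add: ffdet_shape_def)
  ultimately have "1 \<le> ffdet d (\<lambda>i. int (beta d (rect_shape d n) i))" by linarith
  thus ?thesis by (simp add: ffdet_shape_def)
qed

text \<open>One row far from \<open>n\<close> makes one Poisson factor exponentially small; the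
  others are at most 1, and the determinant is polynomial in \<open>n\<close>. The margin
  \<open>d\<close> absorbs the shift of the row. For the rectangle the determinant is at least 1 and
  each Poisson factor at least \<open>1 / fact d\<close>; with the \<open>fact d\<close> of
  \<open>ffdet_bound\<close> this makes the exponent \<open>Suc d\<close>.\<close>

lemma num_chains_tail:
  fixes \<kappa> :: real
  assumes sh: "shape d r" "sum r {..<d} = d * n" and n: "n > 0" and d: "d > 0"
    and \<kappa>: "2 \<le> \<kappa>" "\<kappa> \<le> real n" and i: "i < d" "\<kappa> + real d < \<bar>real (r i) - real n\<bar>"
  shows "real (num_chains (d * n) r) \<le>
    fact d ^ Suc d * (2 * real d * real n) ^ (d * d) * exp (- (\<kappa>\<^sup>2 / (4 * real n))) * real (num_chains (d * n) (rect_shape d n))"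
proof -
  define Z where "Z = (fact (d * n) / (fact n ^ d * real n powr real (\<Sum>i<d. i)) :: real)"
  define E where "E = exp (- (\<kappa>\<^sup>2 / (4 * real n)))"
  \<comment> \<open>A row has at most \<open>d n\<close> cells, and its shift is below
    \<open>d \<le> d n\<close>.\<close>
  define L where "L = 2 * d * n"
  let ?r0 = "rect_shape d n"
  have Z: "Z > 0" using n by (simp add: Z_def)
  have "real (num_chains (d * n) ?r0) = Z * (ffdet_shape d ?r0 * (\<Prod>i<d. pois n (beta d ?r0 i)))"
    unfolding Z_def using shape_rect_shape n by (intro num_chains_pois) (auto simp: rect_shape_def)
  moreover have "1 * (\<Prod>i<d. 1 / fact d) \<le> ffdet_shape d ?r0 * (\<Prod>i<d. pois n (beta d ?r0 i))"
  proof (intro mult_mono prod_mono)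
    fix i assume i: "i \<in> {..<d}"
    hence "(fact (Suc i) :: real) \<le> fact d" by (intro fact_mono) auto
    hence "1 / fact d \<le> (1 / fact (Suc i) :: real)" by (intro divide_left_mono) auto
    also have "\<dots> \<le> pois n (n + i)" by (rule pois_shift_ge[OF n])
    finally show "0 \<le> (1 / fact d :: real) \<and> 1 / fact d \<le> pois n (beta d ?r0 i)"
      using i by (simp add: beta_def rect_shape_def)
  qed (use ffdet_shape_rect_ge in \<open>auto simp: prod_nonneg intro: order.trans[of 0 1]\<close>)
  ultimately have r0: "Z * (1 / fact d) ^ d \<le> real (num_chains (d * n) ?r0)" using Z by simp
  have "ffdet_shape d r \<le> fact d * real L ^ (d * d)"
  proof -
    have "beta d r i \<le> L" if "i < d" for i
    proof -
      have "r (d - 1 - i) \<le> d * n" using sh(2) that member_le_sum[of "d - 1 - i" "{..<d}" r] by simp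
      moreover have "i \<le> d * n" using that n by (metis le_trans less_imp_le mult_le_mono2 mult.right_neutral Suc_leI One_nat_def)
      ultimately show ?thesis by (simp add: beta_def L_def)
    qed
    moreover have "d \<le> L" using n by (simp add: L_def)
    ultimately have "\<bar>ffdet d (\<lambda>i. int (beta d r i))\<bar> \<le> fact d * int L ^ (d * d)"
      by (intro ffdet_bound) auto
    hence "of_int (ffdet d (\<lambda>i. int (beta d r i))) \<le> (of_int (fact d * int L ^ (d * d)) :: real)"
      by (intro of_int_le_iff[THEN iffD2]) linarith
    thus ?thesis by (simp add: ffdet_shape_def)
  qed
  moreover have "(\<Prod>i<d. pois n (beta d r i)) \<le> E"
  proof -
    define j where "j = d - 1 - i"
    have j: "j < d" "beta d r j = r i + j" using i by (auto simp: j_def beta_def)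
    have "\<kappa> \<le> \<bar>real (beta d r j) - real n\<bar>" using i(2) j by simp
    hence *: "pois n (beta d r j) \<le> E" unfolding E_def by (rule pois_tail[OF n \<kappa>])
    have "(\<Prod>i<d. pois n (beta d r i)) = pois n (beta d r j) * (\<Prod>i\<in>{..<d}-{j}. pois n (beta d r i))"
      using j by (intro prod.remove) auto
    also have "\<dots> \<le> E * 1"
      using * pois_le_1[OF n] pois_pos[OF n]
      by (intro mult_mono prod_le_1) (auto simp: E_def less_imp_le intro!: prod_nonneg)
    finally show ?thesis by simp
  qed
  ultimately have "ffdet_shape d r * (\<Prod>i<d. pois n (beta d r i)) \<le> fact d * real L ^ (d * d) * E"
    using pois_pos[OF n] by (intro mult_mono) (auto simp: E_def less_imp_le intro!: prod_nonneg)
  hence "Z * (ffdet_shape d r * (\<Prod>i<d. pois n (beta d r i))) \<le> Z * (fact d * real L ^ (d * d) * E)"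
    using Z by (intro mult_left_mono) auto
  hence "real (num_chains (d * n) r) \<le> Z * (fact d * real L ^ (d * d) * E)"
    using num_chains_pois[OF sh n] by (simp add: Z_def)
  also have "\<dots> = fact d ^ Suc d * real L ^ (d * d) * E * (Z * (1 / fact d) ^ d)"
    by (simp add: power_divide field_simps)
  also have "\<dots> \<le> fact d ^ Suc d * real L ^ (d * d) * E * real (num_chains (d * n) ?r0)"
    using r0 by (intro mult_left_mono) (auto simp: E_def)
  finally show ?thesis by (simp add: E_def L_def)
qed

section \<open>Comparison of the two sums\<close>

text \<open>\<open>\<delta>\<close> is the error of \<open>num_chains_central\<close> at deviation
  \<open>\<kappa> + d\<close>, hence \<open>2 (\<kappa> + d) + d\<close>. In
  \<open>\<epsilon>\<close> the first factor bounds the number of shapes and the square bounds one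
  tail term against that of the rectangle; each of the two sums contributes one
  \<open>\<epsilon>\<close>.\<close>

lemma sum_num_chains_compare:
  fixes \<kappa> \<delta> \<epsilon> S T :: real
  assumes d: "d > 0" and n: "n > 0" and \<kappa>: "2 \<le> \<kappa>" "\<kappa> + real d \<le> real n"
  defines "\<delta> \<equiv> (2 * \<kappa> + 3 * real d) ^ 3 / real (2 * n + d) ^ 2"
  assumes \<delta>: "\<delta> < 1"
  defines "S \<equiv> (\<Sum>r\<in>box_shapes d (d * n) (d * n). (real (num_chains (d * n) r))\<^sup>2)"
    and "T \<equiv> (\<Sum>r\<in>box_shapes d (2 * n) (d * n).
                real (num_chains (d * n) r) * real (num_chains (d * n) (compl_shape d (2 * n) r)))"
    and "\<epsilon> \<equiv> (2 * real d * real n) ^ d *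
       (fact d ^ Suc d * (2 * real d * real n) ^ (d * d) * exp (- (\<kappa>\<^sup>2 / (4 * real n))))\<^sup>2"
  shows "S > 0" and "\<bar>T - S\<bar> \<le> (inverse (1 - \<delta>) ^ d - (1 - \<delta>) ^ d + 2 * \<epsilon>) * S"
proof -
  define F where "F r = real (num_chains (d * n) r)" for r
  define C where "C = compl_shape d (2 * n)"
  define B where "B = box_shapes d (d * n) (d * n)"
  define B' where "B' = box_shapes d (2 * n) (d * n)"
  define G where "G = {r \<in> B. \<forall>i<d. \<bar>real (r i) - real n\<bar> \<le> \<kappa> + real d}"
  define K where "K = fact d ^ Suc d * (2 * real d * real n) ^ (d * d) * exp (- (\<kappa>\<^sup>2 / (4 * real n)))"
  define \<eta> where "\<eta> = inverse (1 - \<delta>) ^ d - (1 - \<delta>) ^ d"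
  let ?r0 = "rect_shape d n"
  have F0: "0 \<le> F r" for r by (simp add: F_def)
  have fin: "finite B" "finite B'" by (simp_all add: B_def B'_def finite_box_shapes)
  have GB: "G \<subseteq> B" by (auto simp: G_def)
  have B'B: "B' \<subseteq> B"
  proof
    fix r assume r: "r \<in> B'"
    have "r 0 \<le> sum r {..<d}" using d by (intro member_le_sum) auto
    thus "r \<in> B" using r by (simp add: B_def B'_def box_shapes_def)
  qed
  \<comment> \<open>By \<open>\<kappa> + d \<le> n\<close> a central first row has length at most
    \<open>2 n\<close>, so central shapes occur in both sums.\<close>
  have GB': "G \<subseteq> B'"
  proof
    fix r assume r: "r \<in> G"
    hence "\<bar>real (r 0) - real n\<bar> \<le> \<kappa> + real d" using d by (simp add: G_def)
    hence "r 0 \<le> 2 * n" using \<kappa> by linarith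
    thus "r \<in> B'" using r by (simp add: G_def B_def B'_def box_shapes_def)
  qed
  have \<delta>0: "0 \<le> \<delta>" using \<kappa> by (simp add: \<delta>_def)
  have "(1 - \<delta>) ^ d \<le> 1" using \<delta>0 \<delta> by (intro power_le_one) auto
  moreover have "1 \<le> inverse (1 - \<delta>) ^ d" using \<delta>0 \<delta> by (intro one_le_power) (simp add: one_le_inverse)
  ultimately have \<eta>: "1 - \<eta> \<le> (1 - \<delta>) ^ d" "inverse (1 - \<delta>) ^ d \<le> 1 + \<eta>" "0 \<le> \<eta>" by (auto simp: \<eta>_def)

  have r0: "?r0 \<in> B"
    using shape_rect_shape[of d n] d by (simp add: B_def box_shapes_def rect_shape_def)
  have "F ?r0 > 0"
  proof -
    have "sum ?r0 {..<d} = d * n" by (simp add: rect_shape_def)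
    moreover have "fact (d * n) * ffdet_shape d ?r0 > 0"
      using ffdet_shape_rect_ge[of d n] by (intro mult_pos_pos) auto
    ultimately have "F ?r0 * (\<Prod>i<d. fact (beta d ?r0 i)) > 0"
      using num_chains_formula[OF shape_rect_shape, of d n "d * n"] by (simp add: F_def ffdet_shape_def)
    thus ?thesis using F0[of ?r0] by (metis mult_zero_left less_eq_real_def less_irrefl)
  qed
  moreover have r0S: "(F ?r0)\<^sup>2 \<le> S"
    unfolding S_def F_def B_def[symmetric] using fin r0
    by (intro member_le_sum[of ?r0 B "\<lambda>r. (real (num_chains (d * n) r))\<^sup>2"]) auto
  ultimately show S: "S > 0" using zero_less_power[of "F ?r0" 2] by linarith

  have tail: "(\<Sum>r\<in>B - G. (F r)\<^sup>2) \<le> \<epsilon> * S"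
  proof -
    have "(F r)\<^sup>2 \<le> K\<^sup>2 * (F ?r0)\<^sup>2" if r: "r \<in> B - G" for r
    proof -
      obtain i where i: "i < d" "\<kappa> + real d < \<bar>real (r i) - real n\<bar>" using r by (auto simp: G_def not_le)
      have "F r \<le> K * F ?r0"
        unfolding F_def K_def using r \<kappa>
        by (intro num_chains_tail[of d r n \<kappa> i, OF _ _ n d _ _ i]) (auto simp: B_def box_shapes_def)
      hence "(F r)\<^sup>2 \<le> (K * F ?r0)\<^sup>2" using F0 by (intro power_mono) auto
      thus ?thesis by (simp add: power_mult_distrib)
    qed
    hence "(\<Sum>r\<in>B - G. (F r)\<^sup>2) \<le> real (card (B - G)) * (K\<^sup>2 * (F ?r0)\<^sup>2)"
      by (intro sum_bounded_above) auto
    also have "\<dots> \<le> (2 * real d * real n) ^ d * (K\<^sup>2 * S)"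
    proof (intro mult_mono)
      have "card (B - G) \<le> card B" using fin by (intro card_mono) auto
      also have "\<dots> \<le> (d * n + 1) ^ d" unfolding B_def by (rule card_box_shapes)
      also have "\<dots> \<le> (2 * d * n) ^ d" using d n by (intro power_mono) (auto simp: Suc_le_eq)
      finally have "real (card (B - G)) \<le> real ((2 * d * n) ^ d)" by (simp only: of_nat_le_iff)
      thus "real (card (B - G)) \<le> (2 * real d * real n) ^ d" by simp
    qed (use r0S in auto)
    finally show ?thesis by (simp add: \<epsilon>_def K_def mult.assoc)
  qed

  have Cin: "C r \<in> B' - G" if r: "r \<in> B' - G" for r
  proof -
    have r': "r \<in> box_shapes d (2 * n) (d * n)" using r by (simp add: B'_def)
    have "C r \<in> B'" using compl_shape_in_box[OF r'] by (simp add: C_def B'_def mult_2 algebra_simps)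
    moreover have "C r \<notin> G"
    proof
      assume CG: "C r \<in> G"
      have "\<bar>real (r i) - real n\<bar> \<le> \<kappa> + real d" if i: "i < d" for i
      proof -
        have "real (C r (d - 1 - i)) = 2 * real n - real (r i)"
          using i box_shapes_le[OF r', of i] by (simp add: C_def compl_shape_def of_nat_diff)
        moreover have "\<bar>real (C r (d - 1 - i)) - real n\<bar> \<le> \<kappa> + real d" using CG i by (simp add: G_def)
        ultimately show ?thesis by linarith
      qed
      thus False using r B'B by (auto simp: G_def)
    qed
    ultimately show ?thesis by simp
  qed
  have CC: "C (C r) = r" if "r \<in> B'" for r
    using that compl_compl_shape by (simp add: B'_def C_def)
  have "(\<Sum>r\<in>B' - G. (F (C r))\<^sup>2) = (\<Sum>r\<in>B' - G. (F r)\<^sup>2)"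
    by (rule sum.reindex_bij_witness[of _ C C]) (use Cin CC in auto)
  moreover have "(\<Sum>r\<in>B' - G. 2 * (F r * F (C r))) \<le> (\<Sum>r\<in>B' - G. (F r)\<^sup>2 + (F (C r))\<^sup>2)"
  proof (rule sum_mono)
    fix r show "2 * (F r * F (C r)) \<le> (F r)\<^sup>2 + (F (C r))\<^sup>2"
      using sum_squares_bound[of "F r" "F (C r)"] by (simp add: mult.assoc)
  qed
  ultimately have "(\<Sum>r\<in>B' - G. F r * F (C r)) \<le> (\<Sum>r\<in>B' - G. (F r)\<^sup>2)"
    by (simp add: sum.distrib sum_distrib_left[symmetric])
  also have "\<dots> \<le> (\<Sum>r\<in>B - G. (F r)\<^sup>2)" using fin B'B by (intro sum_mono2) auto
  finally have tail': "(\<Sum>r\<in>B' - G. F r * F (C r)) \<le> \<epsilon> * S" using tail by linarith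

  have centre: "\<bar>(\<Sum>r\<in>G. F r * F (C r)) - (\<Sum>r\<in>G. (F r)\<^sup>2)\<bar> \<le> \<eta> * S"
  proof -
    have "\<bar>F r * F (C r) - (F r)\<^sup>2\<bar> \<le> \<eta> * (F r)\<^sup>2" if r: "r \<in> G" for r
    proof -
      have \<delta>_alt: "\<delta> = (2 * (\<kappa> + real d) + real d) ^ 3 / real (2 * n + d) ^ 2"
      proof -
        have "2 * (\<kappa> + real d) + real d = 2 * \<kappa> + 3 * real d" by simp
        thus ?thesis by (simp only: \<delta>_def)
      qed
      have "(1 - \<delta>) ^ d * F r \<le> F (C r)" "F (C r) \<le> inverse (1 - \<delta>) ^ d * F r"
        using num_chains_central[of r d n "\<kappa> + real d", folded \<delta>_alt] r GB' d \<delta>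
        by (auto simp: F_def C_def B'_def G_def)
      moreover have "(1 - \<eta>) * F r \<le> (1 - \<delta>) ^ d * F r" "inverse (1 - \<delta>) ^ d * F r \<le> (1 + \<eta>) * F r"
        using \<eta> F0 by (auto intro: mult_right_mono)
      ultimately have "\<bar>F (C r) - F r\<bar> \<le> \<eta> * F r" by (simp add: algebra_simps abs_le_iff)
      hence "F r * \<bar>F (C r) - F r\<bar> \<le> F r * (\<eta> * F r)" using F0 by (intro mult_left_mono) auto
      moreover have "\<bar>F r * F (C r) - (F r)\<^sup>2\<bar> = F r * \<bar>F (C r) - F r\<bar>"
      proof -
        have "F r * F (C r) - (F r)\<^sup>2 = F r * (F (C r) - F r)" by (simp add: power2_eq_square algebra_simps)
        thus ?thesis using F0[of r] by (simp add: abs_mult)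
      qed
      ultimately show ?thesis by (simp add: power2_eq_square mult_ac)
    qed
    hence "(\<Sum>r\<in>G. \<bar>F r * F (C r) - (F r)\<^sup>2\<bar>) \<le> (\<Sum>r\<in>G. \<eta> * (F r)\<^sup>2)" by (rule sum_mono)
    also have "\<dots> = \<eta> * (\<Sum>r\<in>G. (F r)\<^sup>2)" by (simp add: sum_distrib_left)
    also have "\<dots> \<le> \<eta> * S"
      unfolding S_def B_def[symmetric] F_def[symmetric] using \<eta> fin GB by (intro mult_left_mono sum_mono2) auto
    finally show ?thesis
      using sum_abs[of "\<lambda>r. F r * F (C r) - (F r)\<^sup>2" G] by (simp add: sum_subtractf)
  qed

  have "T = (\<Sum>r\<in>B'. F r * F (C r))" by (simp add: T_def B'_def F_def C_def)
  also have "\<dots> = (\<Sum>r\<in>B' - G. F r * F (C r)) + (\<Sum>r\<in>G. F r * F (C r))"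
    by (rule sum.subset_diff) (use fin GB' in auto)
  finally have T: "T = (\<Sum>r\<in>B' - G. F r * F (C r)) + (\<Sum>r\<in>G. F r * F (C r))" .
  have "S = (\<Sum>r\<in>B. (F r)\<^sup>2)" by (simp add: S_def B_def F_def)
  also have "\<dots> = (\<Sum>r\<in>B - G. (F r)\<^sup>2) + (\<Sum>r\<in>G. (F r)\<^sup>2)"
    by (rule sum.subset_diff) (use fin GB in auto)
  finally have S': "S = (\<Sum>r\<in>B - G. (F r)\<^sup>2) + (\<Sum>r\<in>G. (F r)\<^sup>2)" .
  have "0 \<le> (\<Sum>r\<in>B' - G. F r * F (C r))" "0 \<le> (\<Sum>r\<in>B - G. (F r)\<^sup>2)"
    using F0 by (auto intro!: sum_nonneg)
  hence "\<bar>T - S\<bar> \<le> \<eta> * S + 2 * (\<epsilon> * S)"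
    using T S' tail tail' centre by linarith
  also have "\<dots> = (\<eta> + 2 * \<epsilon>) * S" by (simp add: algebra_simps)
  finally show "\<bar>T - S\<bar> \<le> (inverse (1 - \<delta>) ^ d - (1 - \<delta>) ^ d + 2 * \<epsilon>) * S" by (simp only: \<eta>_def)
qed

section \<open>Passage to the limit\<close>

lemma sum_num_chains_asymp_equiv:
  fixes d :: nat
  assumes d: "d > 0"
  shows "(\<lambda>n. \<Sum>r\<in>box_shapes d (d * n) (d * n). (real (num_chains (d * n) r))\<^sup>2) \<sim>[at_top]
    (\<lambda>n. \<Sum>r\<in>box_shapes d (2 * n) (d * n).
        real (num_chains (d * n) r) * real (num_chains (d * n) (compl_shape d (2 * n) r)))"
    (is "?S \<sim>[at_top] ?T")
proof -
  \<comment> \<open>The exponent must lie strictly between 1/2 and 2/3: \<open>\<delta>\<close>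
    tends to 0 only if \<open>\<kappa>\<close> cubed is small against \<open>n\<close> squared,
    while \<open>\<kappa>\<close> squared over \<open>n\<close> must outgrow every multiple of the
    logarithm of \<open>n\<close>.\<close>
  define \<kappa> where "\<kappa> n = real n powr (3 / 5)" for n :: nat
  define \<delta> where "\<delta> n = (2 * \<kappa> n + 3 * real d) ^ 3 / real (2 * n + d) ^ 2" for n :: nat
  define \<epsilon> where "\<epsilon> n = (2 * real d * real n) ^ d *
       (fact d ^ Suc d * (2 * real d * real n) ^ (d * d) * exp (- ((\<kappa> n)\<^sup>2 / (4 * real n))))\<^sup>2" for n :: nat
  define A where "A = (2 * real d) ^ d * (fact d ^ Suc d * (2 * real d) ^ (d * d))\<^sup>2"
  have \<delta>_lim: "\<delta> \<longlonglongrightarrow> 0"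
    unfolding \<delta>_def \<kappa>_def of_nat_add of_nat_mult by real_asymp
  have \<epsilon>_lim: "\<epsilon> \<longlonglongrightarrow> 0"
  proof -
    have "\<epsilon> n = A * (real n ^ (d + 2 * (d * d)) * exp (- (2 * ((real n powr (3 / 5))\<^sup>2 / (4 * real n)))))" for n
      by (simp add: \<epsilon>_def A_def \<kappa>_def power_mult_distrib power_add power_mult[symmetric]
          exp_double[symmetric] mult_ac del: fact_Suc power_Suc)
    hence "\<epsilon> = (\<lambda>n. A * (real n ^ (d + 2 * (d * d)) * exp (- (2 * ((real n powr (3 / 5))\<^sup>2 / (4 * real n))))))"
      by (rule ext)
    moreover have "(\<lambda>n. real n ^ (d + 2 * (d * d)) * exp (- (2 * ((real n powr (3 / 5))\<^sup>2 / (4 * real n))))) \<longlonglongrightarrow> 0"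
      by real_asymp
    ultimately show ?thesis by (simp only: tendsto_mult_right_zero)
  qed
  have lim: "(\<lambda>n. inverse (1 - \<delta> n) ^ d - (1 - \<delta> n) ^ d + 2 * \<epsilon> n) \<longlonglongrightarrow> inverse (1 - 0) ^ d - (1 - 0) ^ d + 2 * 0"
    by (intro tendsto_intros \<delta>_lim \<epsilon>_lim) auto
  have ev: "\<forall>\<^sub>F n in at_top. \<bar>?T n / ?S n - 1\<bar> \<le> inverse (1 - \<delta> n) ^ d - (1 - \<delta> n) ^ d + 2 * \<epsilon> n"
  proof -
    have "\<forall>\<^sub>F n in at_top. \<delta> n < 1" using \<delta>_lim by (rule order_tendstoD) simp
    moreover have "\<forall>\<^sub>F n in at_top. 2 \<le> \<kappa> n" unfolding \<kappa>_def by real_asymp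
    moreover have "\<forall>\<^sub>F n in at_top. \<kappa> n + real d \<le> real n" unfolding \<kappa>_def by real_asymp
    moreover have "\<forall>\<^sub>F n in at_top. 0 < (n :: nat)" by (rule eventually_gt_at_top)
    ultimately show ?thesis
    proof eventually_elim
      case (elim n)
      note * = sum_num_chains_compare[OF d elim(4,2,3), folded \<delta>_def, OF elim(1), folded \<epsilon>_def]
      have "\<bar>?T n / ?S n - 1\<bar> = \<bar>?T n - ?S n\<bar> / ?S n" using *(1) by (simp add: field_simps)
      also have "\<dots> \<le> inverse (1 - \<delta> n) ^ d - (1 - \<delta> n) ^ d + 2 * \<epsilon> n"
        using * by (simp only: pos_divide_le_eq)
      finally show ?case .
    qed
  qed
  have "(\<lambda>n. ?T n / ?S n - 1) \<longlonglongrightarrow> 0"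
  proof (rule tendsto_0_le[OF lim[simplified], where K = 1])
    show "\<forall>\<^sub>F n in at_top. norm (?T n / ?S n - 1) \<le>
        norm (inverse (1 - \<delta> n) ^ d - (1 - \<delta> n) ^ d + 2 * \<epsilon> n) * 1"
      using ev by (rule eventually_mono) simp
  qed
  hence "(\<lambda>n. ?T n / ?S n) \<longlonglongrightarrow> 1" by (simp add: LIM_zero_iff)
  hence "?T \<sim>[at_top] ?S" by (rule asymp_equivI')
  thus ?thesis by (rule asymp_equiv_symI)
qed

theorem theorem2:
  fixes d :: nat
  assumes "d \<ge> 2"
  shows "(\<lambda>n. real (num_perms_no_decreasing d (d * n))) \<sim>[at_top] (\<lambda>n. real (dim_diagram (rect_diagram d (2 * n))))"
proof -
  have "d * (2 * n) - d * n = d * n" "d * n \<le> d * (2 * n)" for n by simp_all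
  hence "real (dim_diagram (rect_diagram d (2 * n))) =
      (\<Sum>r\<in>box_shapes d (2 * n) (d * n).
        real (num_chains (d * n) r) * real (num_chains (d * n) (compl_shape d (2 * n) r)))" for n
    using num_chains_rect_split[of "d * n" d "2 * n"] by (simp add: dim_rect_diagram)
  moreover have "real (num_perms_no_decreasing d (d * n)) =
      (\<Sum>r\<in>box_shapes d (d * n) (d * n). (real (num_chains (d * n) r))\<^sup>2)" for n
    by (simp add: num_perms_no_decreasing_eq)
  ultimately show ?thesis
    using sum_num_chains_asymp_equiv[of d] assms by simp
qed

end
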